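(* Let $k\geq 4$ be an integer, let $B_k$ be the bipyramid over a $k$-gon, and let $\phi$ be Euler's totient function. Then the Koebe degree $\kappa(B_k)$ is at least $\phi(k)/4$. In particular, the Koebe degree of a $3$-polytope is not bounded by any constant.
   Context: A $3$-polytope is a $3$-dimensional convex polytope. Two polytopes are combinatorially equivalent if their face lattices are isomorphic; a realization of $P$ is a polytope in $\mathbb{R}^3$ combinatorially equivalent to $P$. A Koebe realization of a $3$-polytope $P$ is a realization $Q\subset\mathbb{R}^3$ of $P$ such that every edge (line segment) of $Q$ is tangent to the unit sphere $\mathbb{S}^2\subset\mathbb{R}^3$. For a realization $R$, $\mathbb{Q}[R]$ denotes the extension field of $\mathbb{Q}$ generated by all vertex coordinates of $R$. The Koebe degree $\kappa(P)$ is the minimum of the field extension degrees $|\mathbb{Q}[Q]:\mathbb{Q}|$, where $Q$ ranges over all Koebe realizations of $P$ (this minimum is finite). *)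

theory Defs
  imports
    "HOL-Analysis.Analysis"
    "HOL-Algebra.Generated_Fields"
    "HOL-Algebra.Algebraic_Closure_Type"
    "HOL-Number_Theory.Totient"
begin

definition three_polytope :: "(real^3) set \<Rightarrow> bool" where
  "three_polytope P \<longleftrightarrow> polytope P \<and> aff_dim P = 3"

(* The face lattice of a polytope P is {F. F face_of P} ordered by inclusion;
   it contains the improper faces {} and P. *)
definition combinatorially_equivalent :: "(real^3) set \<Rightarrow> (real^3) set \<Rightarrow> bool" where
  "combinatorially_equivalent P Q \<longleftrightarrow>
     (\<exists>f. bij_betw f {F. F face_of P} {G. G face_of Q} \<and>
          (\<forall>F F'. F face_of P \<longrightarrow> F' face_of P \<longrightarrow> (F \<subseteq> F' \<longleftrightarrow> f F \<subseteq> f F')))"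

definition is_realization :: "(real^3) set \<Rightarrow> (real^3) set \<Rightarrow> bool" where
  "is_realization P Q \<longleftrightarrow> polytope Q \<and> combinatorially_equivalent P Q"

(* The line spanned by e meets the unit sphere in a single point, which lies on e. *)
definition tangent_to_unit_sphere :: "(real^3) set \<Rightarrow> bool" where
  "tangent_to_unit_sphere e \<longleftrightarrow> (\<exists>x\<in>e. affine hull e \<inter> sphere 0 1 = {x})"

definition koebe_realization :: "(real^3) set \<Rightarrow> (real^3) set \<Rightarrow> bool" where
  "koebe_realization P Q \<longleftrightarrow>
     is_realization P Q \<and> (\<forall>e. e edge_of Q \<longrightarrow> tangent_to_unit_sphere e)"

abbreviation real_ring :: "real ring" where
  "real_ring \<equiv> ring_of_type_algebra"

definition vertex_coordinates :: "(real^3) set \<Rightarrow> real set" where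
  "vertex_coordinates R = {v $ i | v i. v extreme_point_of R}"

definition coordinate_field :: "(real^3) set \<Rightarrow> real set" where
  "coordinate_field R = generate_field real_ring (\<rat> \<union> vertex_coordinates R)"

definition degree_over_rationals :: "real set \<Rightarrow> enat" where
  "degree_over_rationals E =
     (if ring.finite_dimension real_ring \<rat> E
      then enat (ring.dim real_ring \<rat> E) else \<infinity>)"

(* Since enat is well-ordered, the infimum is attained whenever
   a Koebe realization exists. *)
definition koebe_degree :: "(real^3) set \<Rightarrow> enat" where
  "koebe_degree P =
     (INF Q\<in>{Q. koebe_realization P Q}. degree_over_rationals (coordinate_field Q))"

(* A representative of the combinatorial type B_k: the bipyramid over the regular
   k-gon. Every bipyramid over a k-gon is a realization of it. *)
definition bipyramid :: "nat \<Rightarrow> (real^3) set" where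
  "bipyramid k = convex hull
     ({vector [cos (2 * pi * real j / real k), sin (2 * pi * real j / real k), 0] | j. j < k}
      \<union> {vector [0, 0, 1], vector [0, 0, -1]})"

end

theory Submission
  imports Defs
begin

text \<open>A vertex \<open>v\<close> of a Koebe polytope lies outside the unit sphere; dividing \<open>(v, 1)\<close> by the tangent
  length \<open>\<surd>(|v|\<^sup>2 - 1)\<close> gives a unit spacelike vector of Minkowski space \<open>\<real>\<^sup>3\<^sup>,\<^sup>1\<close>, and two such vectors
  have Lorentz product \<open>-1\<close> whenever the vertices span an edge. For a bipyramid with apices \<open>A\<close>, \<open>B\<close>
  and \<open>\<langle>A, B\<rangle> = -\<beta>\<close> this forces the equatorial vectors to satisfy
  \<open>W\<^sub>i\<^sub>+\<^sub>1 + W\<^sub>i\<^sub>-\<^sub>1 = l W\<^sub>i + m (A + B)\<close> with \<open>l = 2 (3 - \<beta>) / (1 + \<beta>)\<close>. As the sequence has exact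
  period \<open>k\<close>, \<open>l = z + 1/z\<close> for a primitive \<open>k\<close>-th root of unity \<open>z\<close>. The square roots cancel in \<open>\<beta>\<close>,
  so \<open>l\<close> lies in the coordinate field, whose degree is therefore at least \<open>\<phi>(k)/2\<close>. Conversely,
  scaling the regular bipyramid by \<open>1 / cos (\<pi>/k)\<close> horizontally and \<open>1 / sin (\<pi>/k)\<close> vertically gives
  a Koebe realization with algebraic coordinates.\<close>

hide_const (open) module.smult up_ring.coeff up_ring.monom Polynomials.lead_coeff Polynomials.degree Divisibility.prime

section \<open>Integer polynomials vanishing at roots of unity\<close>

definition eval_int :: "int poly \<Rightarrow> 'a::comm_ring_1 \<Rightarrow> 'a" where
  "eval_int p z = poly (map_poly of_int p) z"

lemma eval_int_simps [simp]:
  "eval_int 0 z = 0" "eval_int 1 z = 1"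
  "eval_int (pCons a p) z = of_int a + z * eval_int p z"
  by (simp_all add: eval_int_def map_poly_pCons)

lemma eval_int_add [simp]: "eval_int (p + q) z = eval_int p z + eval_int q z"
  by (induction p q rule: poly_induct2) (simp_all add: algebra_simps)

lemma eval_int_smult [simp]: "eval_int (smult a p) z = of_int a * eval_int p z"
  by (induction p) (simp_all add: algebra_simps)

lemma eval_int_uminus [simp]: "eval_int (- p) z = - eval_int p z"
  using eval_int_smult[of "-1" p z] by simp

lemma eval_int_diff [simp]: "eval_int (p - q) z = eval_int p z - eval_int q z"
  using eval_int_add[of p "- q" z] by simp

lemma eval_int_mult [simp]: "eval_int (p * q) z = eval_int p z * eval_int q z"
  by (induction p) (simp_all add: algebra_simps)

lemma eval_int_power [simp]: "eval_int (p ^ n) z = eval_int p z ^ n"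
  by (induction n) simp_all

lemma eval_int_sum [simp]: "eval_int (sum f A) z = (\<Sum>i\<in>A. eval_int (f i) z)"
  by (induction A rule: infinite_finite_induct) simp_all

lemma eval_int_monom [simp]: "eval_int (monom a n) z = of_int a * z ^ n"
  by (simp add: eval_int_def map_poly_monom poly_monom)

lemma eval_int_pcompose [simp]: "eval_int (pcompose p q) z = eval_int p (eval_int q z)"
  by (induction p) (simp_all add: pcompose_pCons)

lemma eval_int_eq_0_finite:
  assumes "p \<noteq> 0"
  shows "finite {z::complex. eval_int p z = 0}" "card {z::complex. eval_int p z = 0} \<le> degree p"
proof -
  have "map_poly of_int p \<noteq> (0 :: complex poly)"
    using assms by (simp add: map_poly_eq_0_iff)
  moreover have "degree (map_poly of_int p :: complex poly) = degree p"
    by (intro degree_map_poly) auto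
  ultimately show "finite {z::complex. eval_int p z = 0}" "card {z::complex. eval_int p z = 0} \<le> degree p"
    using poly_roots_finite[of "map_poly of_int p :: complex poly"]
      card_poly_roots_bound[of "map_poly of_int p :: complex poly"]
    by (simp_all add: eval_int_def)
qed

lemma freshmans_dream_dvd:
  fixes x y :: "'a::comm_ring_1"
  assumes "prime p"
  shows "of_nat p dvd (x + y) ^ p - x ^ p - y ^ p"
proof -
  have p: "p > 0" using assms prime_gt_0_nat by blast
  have "(x + y) ^ p = (\<Sum>k\<le>p. of_nat (p choose k) * x ^ k * y ^ (p - k))"
    by (rule binomial_ring)
  also have "{..p} = insert 0 (insert p {0<..<p})" by auto
  also have "(\<Sum>k\<in>insert 0 (insert p {0<..<p}). of_nat (p choose k) * x ^ k * y ^ (p - k))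
      = y ^ p + (x ^ p + (\<Sum>k\<in>{0<..<p}. of_nat (p choose k) * x ^ k * y ^ (p - k)))"
    using p by (subst sum.insert; simp)+
  finally have "(x + y) ^ p - x ^ p - y ^ p = (\<Sum>k\<in>{0<..<p}. of_nat (p choose k) * x ^ k * y ^ (p - k))"
    by simp
  also have "of_nat p dvd \<dots>"
  proof (rule dvd_sum)
    fix k assume k: "k \<in> {0<..<p}"
    have "p dvd p choose k"
      using k assms by (intro dvd_choose_prime) auto
    then have "(of_nat p :: 'a) dvd of_nat (p choose k)"
      by (metis dvd_def of_nat_mult)
    then show "(of_nat p :: 'a) dvd of_nat (p choose k) * x ^ k * y ^ (p - k)"
      by (simp add: mult.assoc)
  qed
  finally show ?thesis .
qed

lemma fermat_dvd_int:
  fixes a :: int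
  assumes "prime p"
  shows "int p dvd a ^ p - a"
proof (induction a rule: int_induct[where k = 0])
  case base
  then show ?case using assms by (simp add: prime_gt_0_nat zero_power)
next
  case (step1 i)
  have "int p dvd (i + 1) ^ p - i ^ p - 1 ^ p"
    using freshmans_dream_dvd[OF assms, of i 1] by simp
  from dvd_add[OF this step1(2)] show ?case by (simp add: algebra_simps)
next
  case (step2 i)
  have "int p dvd ((i - 1) + 1) ^ p - (i - 1) ^ p - 1 ^ p"
    using freshmans_dream_dvd[OF assms, of "i - 1" 1] by simp
  from dvd_diff[OF step2(2) this] show ?case by (simp add: algebra_simps)
qed

lemma pcompose_power_prime_dvd:
  fixes f :: "int poly"
  assumes "prime p"
  shows "[:int p:] dvd pcompose f (monom 1 p) - f ^ p"
proof (induction f)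
  case 0
  then show ?case using assms by (simp add: prime_gt_0_nat zero_power)
next
  case (pCons a f)
  let ?X = "monom 1 1 :: int poly"
  have decomp: "pCons a f = [:a:] + ?X * f"
    by (simp add: monom_altdef)
  have X: "?X ^ p = monom 1 p" by (simp add: monom_power)
  have p: "of_nat p = [:int p:]" by (simp add: of_nat_poly)
  have "[:int p:] dvd ([:a:] + ?X * f) ^ p - [:a:] ^ p - (?X * f) ^ p"
    using freshmans_dream_dvd[OF assms, of "[:a:]" "?X * f"] by (simp only: p)
  moreover have "[:int p:] dvd monom 1 p * (pcompose f (monom 1 p) - f ^ p)"
    using pCons.IH by (rule dvd_mult)
  moreover have "[:int p:] dvd [:a:] ^ p - [:a:]"
    using fermat_dvd_int[OF assms, of a] by (simp add: poly_const_pow)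
  ultimately have "[:int p:] dvd monom 1 p * (pcompose f (monom 1 p) - f ^ p)
     - (([:a:] + ?X * f) ^ p - [:a:] ^ p - (?X * f) ^ p) - ([:a:] ^ p - [:a:])"
    by (meson dvd_diff)
  moreover have "pcompose (pCons a f) (monom 1 p) - pCons a f ^ p =
     monom 1 p * (pcompose f (monom 1 p) - f ^ p)
     - (([:a:] + ?X * f) ^ p - [:a:] ^ p - (?X * f) ^ p) - ([:a:] ^ p - [:a:])"
    unfolding decomp[symmetric] power_mult_distrib X
    by (simp add: pcompose_pCons algebra_simps)
  ultimately show ?case by metis
qed

lemma monic_division:
  fixes f g :: "int poly"
  assumes "lead_coeff f = 1"
  obtains q r where "g = f * q + r" "r = 0 \<or> degree r < degree f"
proof -
  obtain q r where qr: "pseudo_divmod g f = (q, r)" by (cases "pseudo_divmod g f")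
  have "f \<noteq> 0" using assms by auto
  from pseudo_divmod[OF this qr] assms that show thesis by auto
qed

text \<open>Any nonzero integer polynomial of least degree vanishing at a root of unity is, up to an
  integer factor, a monic divisor of \<open>x\<^sup>k - 1\<close>, by Gauss' lemma.\<close>

lemma minimal_int_poly_root_of_unity:
  fixes z :: complex
  assumes "k > 0" and "z ^ k = 1"
  obtains f :: "int poly"
  where "lead_coeff f = 1" "eval_int f z = 0"
    "\<And>h. eval_int h z = 0 \<Longrightarrow> h = 0 \<or> degree f \<le> degree h"
proof -
  define u :: "int poly" where "u = monom 1 k - 1"
  have u0: "u \<noteq> 0"
    using assms by (simp add: u_def monom_eq_1_iff)
  have lu: "lead_coeff u = 1"
  proof -
    have "degree (1 :: int poly) < degree (monom (1::int) k)"
      using assms by (simp add: degree_monom_eq)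
    then have "lead_coeff ((-1) + monom 1 k :: int poly) = lead_coeff (monom (1::int) k)"
      by (intro lead_coeff_add_le) simp
    then show ?thesis by (simp add: u_def degree_monom_eq)
  qed
  have uz: "eval_int u z = 0" using assms by (simp add: u_def)
  define P where "P h \<longleftrightarrow> h \<noteq> 0 \<and> eval_int h z = 0" for h :: "int poly"
  have "P u" using u0 uz by (simp add: P_def)
  then obtain h where h: "P h" "\<And>h'. P h' \<Longrightarrow> degree h \<le> degree h'"
    using ex_has_least_nat[of P u degree] by auto
  define f where "f = primitive_part h"
  have hf: "h = smult (content h) f" by (simp add: f_def)
  have h0: "h \<noteq> 0" using h by (simp add: P_def)
  have cf: "content f = 1" using h0 by (simp add: f_def)
  have df: "degree f = degree h" by (simp add: f_def)
  have fz: "eval_int f z = 0"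
    using h h0 hf by (metis P_def content_eq_zero_iff eval_int_smult mult_eq_0_iff of_int_eq_0_iff)
  have f0: "f \<noteq> 0" using cf by auto
  obtain a q where aq: "a \<noteq> 0" "smult a u = f * q + pseudo_mod u f"
    using pseudo_mod(1)[OF f0, of u] by blast
  have "eval_int (pseudo_mod u f) z = 0"
    using arg_cong[OF aq(2), of "\<lambda>p. eval_int p z"] fz uz by simp
  then have "pseudo_mod u f = 0"
    using pseudo_mod(2)[OF f0, of u] h(2)[of "pseudo_mod u f"] df
    by (metis P_def not_le)
  then have fq: "smult a u = f * q" using aq by simp
  then have "content (smult a u) = content q"
    using cf by (simp add: content_mult)
  then have "a dvd content q" by (metis content_smult dvd_triv_left normalize_dvd_iff)
  then have "[:a:] dvd q" by (simp add: const_poly_dvd_iff_dvd_content)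
  then obtain q' where q': "q = [:a:] * q'" by (elim dvdE)
  have "smult a u = smult a (f * q')" using fq q' by simp
  then have uf: "u = f * q'" using aq(1) by (metis smult_cancel)
  then have "lead_coeff f * lead_coeff q' = 1" using lu by (metis lead_coeff_mult)
  then have "lead_coeff f = 1 \<or> lead_coeff f = -1"
    by (metis zmult_eq_1_iff)
  then obtain s where s: "s = 1 \<or> s = (-1::int)" "lead_coeff (smult s f) = 1"
    by (metis lead_coeff_smult mult_minus1 minus_minus mult_1)
  show thesis
  proof (rule that)
    show "lead_coeff (smult s f) = 1" by fact
    show "eval_int (smult s f) z = 0" using fz by simp
    show "h' = 0 \<or> degree (smult s f) \<le> degree h'" if "eval_int h' z = 0" for h'
      using that h(2)[of h'] df s by (auto simp: P_def)
  qed
qed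

text \<open>Landau's argument for the irreducibility of the cyclotomic polynomials: modulo the minimal
  polynomial \<open>f\<close>, the remainder of \<open>f(x\<^sup>p)\<close> is divisible by \<open>p\<close> but takes only finitely many
  values, so it vanishes for every large prime \<open>p\<close>.\<close>

lemma minimal_poly_dvd_pcompose_prime:
  fixes z :: complex and f :: "int poly"
  assumes k: "k > 0" and z: "z ^ k = 1"
    and f: "lead_coeff f = 1" "eval_int f z = 0"
    and min: "\<And>h. eval_int h z = 0 \<Longrightarrow> h = 0 \<or> degree f \<le> degree h"
  obtains N :: nat where "\<And>p. prime p \<Longrightarrow> p > N \<Longrightarrow> f dvd pcompose f (monom 1 p)"
proof -
  have "\<exists>r. \<forall>j. eval_int (r j) z = eval_int f (z ^ j) \<and> (r j = 0 \<or> degree (r j) < degree f)"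
  proof (rule choice, rule allI)
    fix j :: nat
    obtain q r where "pcompose f (monom 1 j) = f * q + r" "r = 0 \<or> degree r < degree f"
      by (rule monic_division[OF f(1), of "pcompose f (monom 1 j)"])
    moreover from this(1) have "eval_int r z = eval_int f (z ^ j)"
      using f(2) by (metis add_0 eval_int_add eval_int_monom eval_int_mult eval_int_pcompose
          mult_zero_left of_int_1 mult_1)
    ultimately show "\<exists>r. eval_int r z = eval_int f (z ^ j) \<and> (r = 0 \<or> degree r < degree f)"
      by blast
  qed
  then obtain r where r: "\<And>j. eval_int (r j) z = eval_int f (z ^ j)"
    "\<And>j. r j = 0 \<or> degree (r j) < degree f" by blast
  have uniq: "g = h" if "eval_int g z = eval_int h z"
    "g = 0 \<or> degree g < degree f" "h = 0 \<or> degree h < degree f" for g h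
  proof (rule ccontr)
    assume "g \<noteq> h"
    then have "degree f \<le> degree (g - h)"
      using min[of "g - h"] that(1) by simp
    moreover have "degree f > 0 \<or> g = 0 \<and> h = 0" using that by auto
    ultimately show False
      using that \<open>g \<noteq> h\<close> degree_diff_le_max[of g h] by (auto simp: max_def split: if_splits)
  qed
  define N where "N = nat (Max (insert 0 ((\<lambda>(j, i). \<bar>coeff (r j) i\<bar>) ` ({..<k} \<times> {..degree f}))))"
  have bound: "\<bar>coeff (r j) i\<bar> \<le> int N" if "j < k" for i j
  proof (cases "i \<le> degree f")
    case True
    then have "\<bar>coeff (r j) i\<bar> \<le> Max (insert 0 ((\<lambda>(j, i). \<bar>coeff (r j) i\<bar>) ` ({..<k} \<times> {..degree f})))"
      using that by (intro Max_ge) auto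
    then show ?thesis by (simp add: N_def)
  next
    case False
    then have "coeff (r j) i = 0" using r(2)[of j] by (auto intro: coeff_eq_0)
    then show ?thesis by simp
  qed
  show thesis
  proof (rule that)
    fix p :: nat assume p: "prime p" "p > N"
    obtain q s where qs: "pcompose f (monom 1 p) = f * q + s" "s = 0 \<or> degree s < degree f"
      by (rule monic_division[OF f(1), of "pcompose f (monom 1 p)"])
    have sz: "eval_int s z = eval_int f (z ^ p)"
      using qs(1) f(2) by (metis add_0 eval_int_add eval_int_monom eval_int_mult eval_int_pcompose
          mult_zero_left of_int_1 mult_1)
    have "z ^ p = z ^ (p mod k)"
      by (metis z mult_div_mod_eq power_add power_mult power_one mult_1)
    then have s: "s = r (p mod k)"
      by (intro uniq) (use r qs(2) sz in auto)
    obtain g where g: "pcompose f (monom 1 p) - f ^ p = [:int p:] * g"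
      using pcompose_power_prime_dvd[OF p(1), of f] by (elim dvdE)
    obtain q' t where t: "g = f * q' + t" "t = 0 \<or> degree t < degree f"
      by (rule monic_division[OF f(1), of g])
    have "eval_int (smult (int p) t) z = eval_int s z"
    proof -
      have "p > 0" using p(1) by (simp add: prime_gt_0_nat)
      have "eval_int g z = eval_int t z" using t(1) f(2) by simp
      moreover have "eval_int f (z ^ p) = of_nat p * eval_int g z"
        using arg_cong[OF g, of "\<lambda>p. eval_int p z"] f(2) \<open>p > 0\<close> by (simp add: zero_power)
      ultimately show ?thesis by (simp add: sz)
    qed
    then have "smult (int p) t = s"
      by (intro uniq) (use t(2) qs(2) p(1) in auto)
    have "s = 0"
    proof (rule poly_eqI)
      fix i
      have "int p dvd coeff s i" using \<open>smult (int p) t = s\<close> by auto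
      moreover have "\<bar>coeff s i\<bar> < int p"
        using bound[of "p mod k" i] p(2) k by (simp add: s)
      ultimately have "coeff s i = 0"
        using zdvd_imp_le[of "int p" "\<bar>coeff s i\<bar>"] by auto
      then show "coeff s i = coeff 0 i" by simp
    qed
    with qs(1) show "f dvd pcompose f (monom 1 p)" by simp
  qed
qed

lemma coprime_imp_large_prime_factors:
  fixes j k N :: nat
  assumes "coprime j k" "k > 0"
  obtains m where "[m = j] (mod k)" "m > 0" "\<And>p. prime p \<Longrightarrow> p dvd m \<Longrightarrow> p > N"
proof -
  define Q where "Q = \<Prod>{p. prime p \<and> p \<le> N \<and> \<not> p dvd j}"
  have fin: "finite {p. prime p \<and> p \<le> N \<and> \<not> p dvd j}"
    by (rule finite_subset[of _ "{..N}"]) auto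
  have notdvd: "\<not> p dvd j + k * Q" if p: "prime p" "p \<le> N" for p
  proof
    assume d: "p dvd j + k * Q"
    show False
    proof (cases "p dvd j")
      case True
      with d have "p dvd k * Q" by (simp add: dvd_add_right_iff)
      then consider "p dvd k" | "p dvd Q" using p prime_dvd_mult_nat by blast
      then show False
      proof cases
        case 1
        with True assms(1) p show False
          by (metis coprime_common_divisor_nat not_prime_1 nat_dvd_1_iff_1 coprime_def)
      next
        case 2
        then obtain p' where "prime p'" "\<not> p' dvd j" "p dvd p'"
          using p fin by (auto simp: Q_def prime_dvd_prod_iff)
        with True p show False by (metis primes_dvd_imp_eq)
      qed
    next
      case False
      then have "p dvd Q" unfolding Q_def using p fin by (intro dvd_prodI) auto
      with d False show False by (metis dvd_add_left_iff dvd_mult)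
    qed
  qed
  have Qp: "Q > 0" unfolding Q_def by (rule prod_pos) (auto simp: prime_gt_0_nat)
  show thesis
  proof (rule that[of "j + k * Q"])
    show "[j + k * Q = j] (mod k)" by (simp add: cong_def)
    show "j + k * Q > 0" using Qp assms(2) by simp
    show "p > N" if "prime p" "p dvd j + k * Q" for p using that notdvd not_le by blast
  qed
qed

theorem totient_le_degree:
  fixes z :: complex and h :: "int poly"
  assumes k: "k > 0" and z: "z ^ k = 1" and prim: "\<And>j. 0 < j \<Longrightarrow> j < k \<Longrightarrow> z ^ j \<noteq> 1"
    and h: "h \<noteq> 0" "eval_int h z = 0"
  shows "totient k \<le> degree h"
proof -
  obtain f where f: "lead_coeff f = 1" "eval_int f z = 0"
    and min: "\<And>h. eval_int h z = 0 \<Longrightarrow> h = 0 \<or> degree f \<le> degree h"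
    using minimal_int_poly_root_of_unity[OF k z] by blast
  obtain N where N: "\<And>p. prime p \<Longrightarrow> p > N \<Longrightarrow> f dvd pcompose f (monom 1 p)"
    using minimal_poly_dvd_pcompose_prime[OF k z f min] by blast
  have step: "eval_int f (w ^ p) = 0" if p: "prime p" "p > N" "eval_int f w = 0" for p and w :: complex
  proof -
    obtain q where "pcompose f (monom 1 p) = f * q" using N[OF p(1,2)] by (elim dvdE)
    then have "eval_int f (eval_int (monom 1 p) w) = eval_int f w * eval_int q w"
      by (metis eval_int_mult eval_int_pcompose)
    with p(3) show ?thesis by simp
  qed
  have large: "eval_int f (w ^ m) = 0"
    if "m > 0" "\<And>p. prime p \<Longrightarrow> p dvd m \<Longrightarrow> p > N" "eval_int f w = 0" for m and w :: complex
    using that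
  proof (induction m arbitrary: w rule: less_induct)
    case (less m)
    show ?case
    proof (cases "m = 1")
      case False
      then obtain p where p: "prime p" "p dvd m" using prime_factor_nat by blast
      then obtain m' where m': "m = p * m'" by (elim dvdE)
      have "m' < m" "m' > 0" using m' less.prems(1) prime_gt_1_nat[OF p(1)] by auto
      moreover have "eval_int f (w ^ p) = 0"
        using step p less.prems by blast
      ultimately have "eval_int f ((w ^ p) ^ m') = 0"
        using less.prems(2) m' \<open>m' < m\<close> \<open>m' > 0\<close>
        by - (rule less.IH, auto intro: dvd_mult)
      then show ?thesis by (simp add: m' power_mult)
    qed (use less.prems in simp)
  qed
  have "eval_int f (z ^ j) = 0" if "j \<in> totatives k" for j
  proof -
    have "coprime j k" using that by (simp add: totatives_def)
    then obtain m where m: "[m = j] (mod k)" "m > 0" "\<And>p. prime p \<Longrightarrow> p dvd m \<Longrightarrow> p > N"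
      using coprime_imp_large_prime_factors[of j k N] k by metis
    have "z ^ m = z ^ (m mod k)" "z ^ j = z ^ (j mod k)"
      by (metis z mult_div_mod_eq power_add power_mult power_one mult_1)+
    then have "z ^ j = z ^ m" using m(1) by (simp add: cong_def)
    with large[OF m(2,3) f(2)] show ?thesis by simp
  qed
  then have sub: "(\<lambda>j. z ^ j) ` totatives k \<subseteq> {w. eval_int f w = 0}" by auto
  have z0: "z \<noteq> 0" using z k by (auto simp: zero_power)
  have inj: "inj_on (\<lambda>j. z ^ j) (totatives k)"
  proof (rule linorder_inj_onI')
    fix i j assume ij: "i \<in> totatives k" "j \<in> totatives k" "i < j"
    then have "z ^ (j - i) \<noteq> 1"
      by (intro prim) (auto simp: totatives_def)
    moreover have "z ^ j = z ^ i * z ^ (j - i)" using ij by (simp flip: power_add)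
    ultimately show "z ^ i \<noteq> z ^ j" using z0 by auto
  qed
  have f0: "f \<noteq> 0" using f by auto
  have "totient k = card ((\<lambda>j. z ^ j) ` totatives k)"
    by (simp add: totient_def card_image[OF inj])
  also have "\<dots> \<le> card {w::complex. eval_int f w = 0}"
    using eval_int_eq_0_finite(1)[OF f0] sub by (rule card_mono)
  also have "\<dots> \<le> degree f" by (rule eval_int_eq_0_finite(2)[OF f0])
  also have "\<dots> \<le> degree h" using min[OF h(2)] h(1) by blast
  finally show ?thesis .
qed

section \<open>Dimension of real number fields\<close>

lemma eval_int_of_real: "eval_int p (complex_of_real x) = of_real (eval_int p x)"
  by (induction p) simp_all

lemma totient_le_twice_degree:
  fixes z :: complex and p :: "int poly"
  assumes k: "k > 0" and z: "z ^ k = 1" and prim: "\<And>j. 0 < j \<Longrightarrow> j < k \<Longrightarrow> z ^ j \<noteq> 1"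
    and p: "p \<noteq> 0" "eval_int p (z + inverse z) = 0"
  shows "totient k \<le> 2 * degree p"
proof -
  define d where "d = degree p"
  define h :: "int poly"
    where "h = (\<Sum>i\<le>d. smult (coeff p i) ((monom 1 2 + 1) ^ i * monom 1 (d - i)))"
  have z0: "z \<noteq> 0" using z k by (auto simp: zero_power)
  have "eval_int p w = (\<Sum>i\<le>d. of_int (coeff p i) * w ^ i)" for w :: complex
  proof -
    have "p = (\<Sum>i\<le>d. monom (coeff p i) i)"
      by (simp add: d_def poly_as_sum_of_monoms)
    then have "eval_int p w = eval_int (\<Sum>i\<le>d. monom (coeff p i) i) w" by simp
    then show ?thesis by simp
  qed
  then have "0 = z ^ d * (\<Sum>i\<le>d. of_int (coeff p i) * (z + inverse z) ^ i)"
    using p(2) by simp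
  also have "\<dots> = (\<Sum>i\<le>d. of_int (coeff p i) * ((z\<^sup>2 + 1) ^ i * z ^ (d - i)))"
    unfolding sum_distrib_left
  proof (rule sum.cong)
    fix i assume "i \<in> {..d}"
    then have "z ^ d = z ^ i * z ^ (d - i)" by (simp flip: power_add)
    then have "z ^ d * (of_int (coeff p i) * (z + inverse z) ^ i) =
        of_int (coeff p i) * ((z ^ i * (z + inverse z) ^ i) * z ^ (d - i))"
      by (simp only: mult_ac)
    moreover have "z ^ i * (z + inverse z) ^ i = (z\<^sup>2 + 1) ^ i"
      unfolding power_mult_distrib[symmetric] using z0
      by (simp add: distrib_left power2_eq_square)
    ultimately show "z ^ d * (of_int (coeff p i) * (z + inverse z) ^ i) =
        of_int (coeff p i) * ((z\<^sup>2 + 1) ^ i * z ^ (d - i))"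
      by simp
  qed simp
  also have "\<dots> = eval_int h z" by (simp add: h_def)
  finally have hz: "eval_int h z = 0" ..
  have "eval_int h (0::int) = (\<Sum>i\<le>d. coeff p i * 0 ^ (d - i))"
    by (simp add: h_def)
  also have "\<dots> = (\<Sum>i\<in>{d}. coeff p i * 0 ^ (d - i))"
    by (rule sum.mono_neutral_right) auto
  also have "\<dots> = lead_coeff p" by (simp add: d_def)
  finally have h0: "h \<noteq> 0" using p(1) by auto
  have "totient k \<le> degree h"
    by (rule totient_le_degree[OF k z prim h0 hz])
  also have "degree h \<le> 2 * d"
    unfolding h_def
  proof (rule degree_sum_le)
    fix i assume i: "i \<in> {..d}"
    have "degree (monom 1 2 + 1 :: int poly) \<le> 2"
      by (rule degree_add_le) (auto simp: degree_monom_le)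
    then have "degree ((monom 1 2 + 1 :: int poly) ^ i) \<le> 2 * i"
      by (metis degree_power_le mult.commute mult_le_mono2 order_trans)
    moreover have "degree (monom (1::int) (d - i)) \<le> d - i" by (rule degree_monom_le)
    ultimately have "degree ((monom 1 2 + 1 :: int poly) ^ i * monom 1 (d - i)) \<le> 2 * i + (d - i)"
      by (meson add_mono degree_mult_le order_trans)
    then show "degree (smult (coeff p i) ((monom 1 2 + 1) ^ i * monom 1 (d - i))) \<le> 2 * d"
      using i degree_smult_le[of "coeff p i" "(monom 1 2 + 1) ^ i * monom 1 (d - i)"] by simp
  qed simp
  finally show ?thesis by (simp add: d_def)
qed

lemma finite_rats_common_denominator:
  fixes A :: "real set"
  assumes "finite A" "A \<subseteq> \<rat>"
  shows "\<exists>d::int. d > 0 \<and> (\<forall>q\<in>A. of_int d * q \<in> \<int>)"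
  using assms
proof (induction A rule: finite_induct)
  case empty
  then show ?case by (auto intro: exI[of _ 1])
next
  case (insert q A)
  then obtain d :: int where d: "d > 0" "\<forall>q\<in>A. of_int d * q \<in> \<int>" by auto
  from insert.prems obtain a b :: int where ab: "b > 0" "q = of_int a / of_int b"
    by (auto elim!: Rats_cases')
  have "of_int (b * d) * q' \<in> \<int>" if "q' \<in> insert q A" for q'
  proof (cases "q' = q")
    case True
    then have "of_int (b * d) * q' = of_int (d * a)" using ab by simp
    then show ?thesis by (metis Ints_of_int)
  next
    case False
    then have "of_int b * (of_int d * q') \<in> \<int>" using that d(2) by - (rule Ints_mult[OF Ints_of_int], blast)
    then show ?thesis by (simp add: mult.assoc)
  qed
  then show ?case using d ab by (intro exI[of _ "b * d"]) auto
qed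

fun chebyshev :: "nat \<Rightarrow> int poly" where
  "chebyshev 0 = 1"
| "chebyshev (Suc 0) = monom 1 1"
| "chebyshev (Suc (Suc n)) = smult 2 (monom 1 1 * chebyshev (Suc n)) - chebyshev n"

lemma eval_chebyshev: "eval_int (chebyshev n) (cos x) = cos (real n * x)"
proof (induction n rule: chebyshev.induct)
  case (3 n)
  have "cos (real (Suc (Suc n)) * x) + cos (real n * x) = 2 * cos x * cos (real (Suc n) * x)"
    using cos_times_cos[of "real (Suc n) * x" x] by (simp add: algebra_simps)
  with 3 show ?case by (simp add: mult.assoc)
qed simp_all


context
begin

interpretation real_field: field real_ring
  by rule

lemma real_ring_simps [simp]:
  "carrier real_ring = UNIV" "x \<oplus>\<^bsub>real_ring\<^esub> y = x + y" "x \<otimes>\<^bsub>real_ring\<^esub> y = x * y"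
  "\<zero>\<^bsub>real_ring\<^esub> = 0" "\<one>\<^bsub>real_ring\<^esub> = 1"
  by (simp_all add: ring_of_type_algebra_def)

lemma real_ring_uminus [simp]: "\<ominus>\<^bsub>real_ring\<^esub> x = - x"
  by (rule real_field.minus_equality) simp_all

lemma real_ring_inv [simp]: "x \<noteq> 0 \<Longrightarrow> inv\<^bsub>real_ring\<^esub> x = inverse x"
  by (rule real_field.comm_inv_char) simp_all

lemma real_ring_pow [simp]: "x [^]\<^bsub>real_ring\<^esub> (n::nat) = x ^ n"
  by (induction n) (simp_all add: real_field.nat_pow_Suc mult.commute)

lemma subfield_Rats: "subfield \<rat> real_ring"
  by (intro real_field.subfieldI' real_field.subringI) (auto simp: Rats_inverse)

lemma subfield_closed:
  assumes "subfield E real_ring"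
  shows "1 \<in> E" "0 \<in> E" "x \<in> E \<Longrightarrow> y \<in> E \<Longrightarrow> x + y \<in> E" "x \<in> E \<Longrightarrow> y \<in> E \<Longrightarrow> x * y \<in> E"
    "x \<in> E \<Longrightarrow> y \<in> E \<Longrightarrow> x - y \<in> E" "x \<in> E \<Longrightarrow> y \<in> E \<Longrightarrow> x / y \<in> E"
proof -
  note sr = subfieldE(1)[OF assms]
  show "1 \<in> E" "0 \<in> E" using subringE(2,3)[OF sr] by simp_all
  show "x + y \<in> E" if "x \<in> E" "y \<in> E" for x y using subringE(7)[OF sr that] by simp
  show mult: "x * y \<in> E" if "x \<in> E" "y \<in> E" for x y using subringE(6)[OF sr that] by simp
  show "x - y \<in> E" if "x \<in> E" "y \<in> E" for x y
    using subringE(7)[OF sr that(1) subringE(5)[OF sr that(2)]] by simp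
  have "inverse y \<in> E" if "y \<in> E" for y
    using real_field.subfield_m_inv(1)[OF assms, of y] that \<open>0 \<in> E\<close> by (cases "y = 0") auto
  then show "x / y \<in> E" if "x \<in> E" "y \<in> E" for x y
    using mult that by (simp add: divide_inverse)
qed

lemma dimension_imp_int_poly:
  assumes n: "real_field.dimension n \<rat> E" and E: "subfield E real_ring" and x: "x \<in> E"
  obtains p :: "int poly" where "p \<noteq> 0" "degree p \<le> n" "eval_int p x = 0"
proof -
  define Us where "Us = map (\<lambda>i. x ^ i) [0..<Suc n]"
  have "x ^ i \<in> E" for i
    by (induction i) (use x subfield_closed[OF E] in auto)
  then have "set Us \<subseteq> E" by (auto simp: Us_def)
  then have "real_field.dependent \<rat> Us"
    using real_field.independent_length_le_dimension[OF subfield_Rats n, of Us]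
    by (auto simp: Us_def)
  then obtain Ks where Ks: "length Ks = length Us" "real_field.combine Ks Us = 0"
    "set Ks \<subseteq> \<rat>" "set Ks \<noteq> {0}"
    using real_field.dependent_imp_non_trivial_combine[OF subfield_Rats, of Us] by auto
  have "real_field.combine Ks Us = (\<Sum>i<length Us. Ks ! i * Us ! i)"
    using Ks(1)
    by (induction Ks Us rule: list_induct2) (simp_all add: sum.lessThan_Suc_shift del: sum.lessThan_Suc)
  then have comb: "(\<Sum>i\<le>n. Ks ! i * x ^ i) = 0"
    using Ks(2) by (simp add: Us_def lessThan_Suc_atMost del: upt_Suc)
  obtain d :: int where d: "d > 0" "\<And>q. q \<in> set Ks \<Longrightarrow> of_int d * q \<in> \<int>"
    using finite_rats_common_denominator[of "set Ks"] Ks(3) by auto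
  have len: "length Ks = Suc n" using Ks(1) by (simp add: Us_def)
  define a where "a i = \<lfloor>of_int d * Ks ! i\<rfloor>" for i
  have a: "of_int (a i) = of_int d * Ks ! i" if "i \<le> n" for i
    using d(2)[of "Ks ! i"] that len by (auto simp: a_def elim!: Ints_cases)
  define p where "p = (\<Sum>i\<le>n. monom (a i) i)"
  have "\<not> set Ks \<subseteq> {0}" using len Ks(4) by (auto simp: subset_singleton_iff)
  then obtain q where "q \<in> set Ks" "q \<noteq> 0" by blast
  then obtain i where i: "i \<le> n" "Ks ! i \<noteq> 0"
    using len by (metis in_set_conv_nth less_Suc_eq_le)
  have "coeff p i = a i" using i(1) by (simp add: p_def coeff_sum)
  moreover have "real_of_int (a i) \<noteq> 0" using a[OF i(1)] i(2) d(1) by simp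
  ultimately have "p \<noteq> 0" by auto
  moreover have "degree p \<le> n"
    unfolding p_def by (rule degree_sum_le) (auto intro: order_trans[OF degree_monom_le])
  moreover have "eval_int p x = 0"
  proof -
    have "eval_int p x = (\<Sum>i\<le>n. of_int d * (Ks ! i * x ^ i))"
      by (simp add: p_def a mult.assoc)
    also have "\<dots> = 0" using comb by (simp flip: sum_distrib_left)
    finally show ?thesis .
  qed
  ultimately show thesis using that by blast
qed

lemma totient_le_twice_dimension:
  fixes z :: complex
  assumes "k > 0" "z ^ k = 1" "\<And>j. 0 < j \<Longrightarrow> j < k \<Longrightarrow> z ^ j \<noteq> 1"
    and "real_field.dimension n \<rat> E" "subfield E real_ring" "x \<in> E" "complex_of_real x = z + inverse z"
  shows "totient k \<le> 2 * n"
proof -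
  obtain p where p: "p \<noteq> 0" "degree p \<le> n" "eval_int p x = 0"
    using dimension_imp_int_poly[OF assms(4-6)] .
  have "eval_int p (z + inverse z) = 0"
    using p(3) by (simp add: assms(7)[symmetric] eval_int_of_real)
  from totient_le_twice_degree[OF assms(1-3) p(1) this] p(2) show ?thesis by linarith
qed

lemma algebraic_realI:
  fixes p :: "int poly"
  assumes "p \<noteq> 0" "eval_int p x = 0"
  shows "(real_field.algebraic over \<rat>) x"
proof (rule real_field.algebraicI)
  define cs where "cs n = map (\<lambda>i. real_of_int (coeff p i)) (rev [0..<n])" for n
  have "real_field.eval (cs n) x = (\<Sum>i<n. of_int (coeff p i) * x ^ i)" for n
    by (induction n) (simp_all add: cs_def)
  then have "real_field.eval (cs (Suc (degree p))) x = eval_int (\<Sum>i\<le>degree p. monom (coeff p i) i) x"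
    by (simp add: lessThan_Suc_atMost)
  then show "real_field.eval (cs (Suc (degree p))) x = \<zero>\<^bsub>real_ring\<^esub>"
    using assms(2) by (simp add: poly_as_sum_of_monoms)
  show "cs (Suc (degree p)) \<noteq> []" by (simp add: cs_def)
  show "cs (Suc (degree p)) \<in> carrier (\<rat> [X]\<^bsub>real_ring\<^esub>)"
    using assms(1) by (auto simp: univ_poly_def polynomial_def cs_def)
qed

lemma finite_dimension_generate_field:
  assumes "finite A" "\<And>x. x \<in> A \<Longrightarrow> (real_field.algebraic over \<rat>) x"
  shows "real_field.finite_dimension \<rat> (generate_field real_ring (\<rat> \<union> A))"
proof -
  obtain xs where xs: "set xs = A" using finite_list[OF assms(1)] by blast
  define F where "F = real_field.finite_extension \<rat> xs"
  have F: "subfield F real_ring" "real_field.finite_dimension \<rat> F" "\<rat> \<subseteq> F" "A \<subseteq> F"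
    using real_field.finite_extension_is_subfield[OF subfield_Rats, of xs]
      real_field.finite_extension_finite_dimension(1)[OF subfield_Rats, of xs]
      real_field.finite_extension_incl[of \<rat> xs]
      real_field.finite_extension_mem[OF subfieldE(1)[OF subfield_Rats], of xs] assms(2) xs
    by (auto simp: F_def)
  let ?G = "generate_field real_ring (\<rat> \<union> A)"
  have G: "subfield ?G real_ring" by (rule real_field.generate_field_is_subfield) simp
  have "\<rat> \<subseteq> ?G" by (auto intro: generate_field.incl)
  then have "subalgebra \<rat> ?G real_ring"
    using real_field.generate_field_is_add_subgroup[of "\<rat> \<union> A"] subfield_closed(4)[OF G]
    by (auto simp: subalgebra_def subalgebra_axioms_def)
  moreover have "?G \<subseteq> F"
    using real_field.generate_field_min_subfield1[of "\<rat> \<union> A" F] F by auto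
  ultimately show ?thesis
    using real_field.subalbegra_incl_imp_finite_dimension[OF subfield_Rats F(2)] by blast
qed

lemma algebraic_cos:
  assumes "n > 0" "cos (real n * x) = of_int a"
  shows "(real_field.algebraic over \<rat>) (cos x)"
proof (rule algebraic_realI)
  show "eval_int (chebyshev n - [:a:]) (cos x) = 0"
    by (simp add: eval_chebyshev assms(2))
  show "chebyshev n - [:a:] \<noteq> 0"
  proof
    assume "chebyshev n - [:a:] = 0"
    then have "chebyshev n = [:a:]" by simp
    then have "cos (real n * y) = of_int a" for y
      using eval_chebyshev[of n y] by simp
    from this[of 0] this[of "pi / (2 * real n)"] show False using assms(1) by simp
  qed
qed

end

section \<open>Edges of the bipyramid\<close>

lemma closed_segment_edge_of:
  assumes "closed_segment a b face_of S" "a \<noteq> b"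
  shows "closed_segment a b edge_of S"
  using assms by (simp add: edge_of_def segment_convex_hull aff_dim_convex_hull aff_dim_2)

lemma combinatorially_equivalent_trans:
  assumes "combinatorially_equivalent P Q" "combinatorially_equivalent Q R"
  shows "combinatorially_equivalent P R"
proof -
  obtain f where f: "bij_betw f {F. F face_of P} {F. F face_of Q}"
    "\<And>F F'. F face_of P \<Longrightarrow> F' face_of P \<Longrightarrow> (F \<subseteq> F' \<longleftrightarrow> f F \<subseteq> f F')"
    using assms(1) by (auto simp: combinatorially_equivalent_def)
  obtain g where g: "bij_betw g {F. F face_of Q} {F. F face_of R}"
    "\<And>F F'. F face_of Q \<Longrightarrow> F' face_of Q \<Longrightarrow> (F \<subseteq> F' \<longleftrightarrow> g F \<subseteq> g F')"
    using assms(2) by (auto simp: combinatorially_equivalent_def)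
  have "f F face_of Q" if "F face_of P" for F
    using f(1) that by (auto simp: bij_betw_def)
  then show ?thesis
    using f g bij_betw_trans[OF f(1) g(1)]
    unfolding combinatorially_equivalent_def by (intro exI[of _ "g \<circ> f"]) auto
qed

lemma combinatorially_equivalent_linear_image:
  fixes h :: "real^3 \<Rightarrow> real^3"
  assumes "linear h" "inj h"
  shows "combinatorially_equivalent P (h ` P)"
  unfolding combinatorially_equivalent_def
proof (intro exI[of _ "(`) h"] conjI allI impI)
  show "bij_betw ((`) h) {F. F face_of P} {G. G face_of h ` P}"
    unfolding faces_of_linear_image[OF assms]
    by (intro inj_on_imp_bij_betw inj_onI) (simp add: inj_image_eq_iff[OF assms(2)])
  show "F \<subseteq> F' \<longleftrightarrow> h ` F \<subseteq> h ` F'" for F F'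
    by (simp add: inj_image_subset_iff[OF assms(2)])
qed

lemma combinatorially_equivalent_edges:
  assumes P: "polytope P" and Q: "polytope Q" and eq: "combinatorially_equivalent P Q"
  obtains g where "\<And>v. v extreme_point_of P \<Longrightarrow> g v extreme_point_of Q"
    "inj_on g {v. v extreme_point_of P}"
    "\<And>v w. v \<noteq> w \<Longrightarrow> closed_segment v w face_of P \<Longrightarrow> closed_segment (g v) (g w) edge_of Q"
proof -
  obtain f where bij: "bij_betw f {F. F face_of P} {F. F face_of Q}"
    and mono: "\<And>F F'. F face_of P \<Longrightarrow> F' face_of P \<Longrightarrow> (F \<subseteq> F' \<longleftrightarrow> f F \<subseteq> f F')"
    using eq by (auto simp: combinatorially_equivalent_def)
  have face: "f F face_of Q" if "F face_of P" for F
    using bij that by (auto simp: bij_betw_def)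
  have surj: "\<exists>F. F face_of P \<and> f F = G" if "G face_of Q" for G
  proof -
    have "G \<in> f ` {F. F face_of P}" using bij that by (simp add: bij_betw_def)
    then show ?thesis by auto
  qed
  have inj: "F = F'" if "F face_of P" "F' face_of P" "f F = f F'" for F F'
    using bij that by (auto simp: bij_betw_def inj_on_def)
  have empty: "f {} = {}"
  proof -
    obtain F where "F face_of P" "f F = {}" using surj[of "{}"] by auto
    then show ?thesis using mono[of "{}" F] by auto
  qed
  have extr: "\<exists>x. x extreme_point_of F" if "polytope F" "F \<noteq> {}" for F :: "(real^3) set"
    using extreme_point_exists_convex[of F] that polytope_imp_compact polytope_imp_convex by metis
  have atom: "\<exists>x. f {v} = {x}" if v: "v extreme_point_of P" for v
  proof -
    have vf: "{v} face_of P" using v by (simp add: face_of_singleton)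
    have "f {v} \<noteq> {}" using inj[OF vf, of "{}"] empty by auto
    then obtain x where "x extreme_point_of f {v}"
      using extr[of "f {v}"] face_of_polytope_polytope[OF Q face[OF vf]] by auto
    then have x: "x extreme_point_of Q" "x \<in> f {v}"
      using extreme_point_of_face[OF face[OF vf]] by auto
    then obtain F where F: "F face_of P" "f F = {x}"
      using surj[of "{x}"] by (auto simp: face_of_singleton)
    then have "F \<subseteq> {v}" using mono[OF F(1) vf] x(2) by simp
    then have "F = {v}" using F(2) empty by (metis insert_not_empty subset_singletonD)
    with F(2) show ?thesis by auto
  qed
  define g where "g v = (THE x. f {v} = {x})" for v
  have g: "f {v} = {g v}" if v: "v extreme_point_of P" for v
  proof -
    obtain x where x: "f {v} = {x}" using atom[OF v] ..
    then show ?thesis by (simp add: g_def)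
  qed
  have g_extreme: "g v extreme_point_of Q" if "v extreme_point_of P" for v
    using face[of "{v}"] that g[OF that] by (simp add: face_of_singleton)
  have g_inj: "inj_on g {v. v extreme_point_of P}"
  proof (rule inj_onI)
    fix v w assume vw: "v \<in> {v. v extreme_point_of P}" "w \<in> {v. v extreme_point_of P}" "g v = g w"
    then have "{v} = {w}" using inj[of "{v}" "{w}"] g by (simp add: face_of_singleton)
    then show "v = w" by simp
  qed
  have "closed_segment (g v) (g w) edge_of Q" if vw: "v \<noteq> w" "closed_segment v w face_of P" for v w
  proof -
    let ?G = "f (closed_segment v w)"
    have ext: "v extreme_point_of P" "w extreme_point_of P"
      using extreme_point_of_face[OF vw(2)] by (auto simp: extreme_point_of_segment)
    have G: "?G face_of Q" "polytope ?G"
      using face[OF vw(2)] face_of_polytope_polytope[OF Q] by auto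
    have "f {v} \<subseteq> ?G" "f {w} \<subseteq> ?G"
      using mono[of "{v}"] mono[of "{w}"] ext vw(2) by (auto simp: face_of_singleton)
    then have sub: "{g v, g w} \<subseteq> ?G" using g ext by auto
    have "z \<in> {g v, g w}" if z: "z extreme_point_of ?G" for z
    proof -
      have z': "z extreme_point_of Q" "{z} \<subseteq> ?G"
        using z extreme_point_of_face[OF G(1)] by auto
      obtain F where F: "F face_of P" "f F = {z}"
        using surj[of "{z}"] z'(1) by (auto simp: face_of_singleton)
      then have Fsub: "F \<subseteq> closed_segment v w" using mono[OF F(1) vw(2)] z'(2) by simp
      have "F \<noteq> {}" using F(2) empty by auto
      then obtain u where u: "u extreme_point_of F"
        using extr[of F] face_of_polytope_polytope[OF P F(1)] by auto
      then have u': "u extreme_point_of P" "u \<in> F" using extreme_point_of_face[OF F(1)] by auto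
      have "f {u} \<subseteq> {z}"
        using mono[of "{u}" F] F u' by (auto simp: face_of_singleton)
      then have "g u = z" using g[OF u'(1)] by simp
      moreover have "u extreme_point_of closed_segment v w"
        using extreme_point_of_face[OF vw(2)] u' Fsub by auto
      then have "u = v \<or> u = w" by (simp add: extreme_point_of_segment)
      ultimately show ?thesis by auto
    qed
    then have "?G \<subseteq> convex hull {g v, g w}"
      using Krein_Milman_Minkowski[OF polytope_imp_compact[OF G(2)] polytope_imp_convex[OF G(2)]]
      by (metis (no_types, lifting) hull_mono mem_Collect_eq subsetI)
    moreover have "convex hull {g v, g w} \<subseteq> ?G"
      using sub polytope_imp_convex[OF G(2)] by (rule hull_minimal)
    ultimately have "?G = closed_segment (g v) (g w)"
      by (simp add: segment_convex_hull)
    moreover have "g v \<noteq> g w" using g_inj ext vw(1) by (auto simp: inj_on_def)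
    ultimately show ?thesis using G(1) by (metis closed_segment_edge_of)
  qed
  then show thesis using that[of g] g_extreme g_inj by blast
qed

lemma face_of_convex_hull_supporting:
  fixes S :: "'a::euclidean_space set"
  assumes "finite S" "T \<subseteq> S" "\<And>x. x \<in> T \<Longrightarrow> u \<bullet> x = c" "\<And>x. x \<in> S - T \<Longrightarrow> u \<bullet> x < c"
  shows "convex hull T face_of convex hull S"
proof (rule face_of_convex_hulls[OF assms(1,2)])
  have "affine hull T \<subseteq> {x. u \<bullet> x = c}"
    using assms(3) by (intro hull_minimal affine_hyperplane) auto
  moreover have "convex hull (S - T) \<subseteq> {x. u \<bullet> x < c}"
    using assms(4) by (intro hull_minimal convex_halfspace_lt) auto
  ultimately show "affine hull T \<inter> convex hull (S - T) = {}" by fastforce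
qed

definition equator :: "nat \<Rightarrow> int \<Rightarrow> real^3" where
  "equator k j = vector [cos (2 * pi * j / k), sin (2 * pi * j / k), 0]"

definition apex :: "real \<Rightarrow> real^3" where
  "apex s = vector [0, 0, s]"

lemma inner_real_3: "x \<bullet> y = x $ 1 * y $ 1 + x $ 2 * y $ 2 + x $ 3 * y $ 3" for x y :: "real^3"
  by (simp add: inner_vec_def sum_3)

lemma equator_apex_nth [simp]:
  "equator k j $ 1 = cos (2 * pi * j / k)" "equator k j $ 2 = sin (2 * pi * j / k)" "equator k j $ 3 = 0"
  "apex s $ 1 = 0" "apex s $ 2 = 0" "apex s $ 3 = s"
  by (simp_all add: equator_def apex_def)

lemma equator_cong:
  assumes "int k dvd i - j"
  shows "equator k i = equator k j"
proof (cases "k = 0")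
  case False
  obtain q where "i - j = int k * q" using assms by (elim dvdE)
  then have "i = j + int k * q" by simp
  then have "2 * pi * i / k = 2 * pi * j / k + 2 * pi * of_int q"
    using False by (simp add: field_simps)
  then show ?thesis by (simp add: equator_def cos_add sin_add)
qed (use assms in simp)

lemma inner_equator: "equator k i \<bullet> equator k j = cos (2 * pi * (i - j) / k)"
proof -
  have "2 * pi * (i - j) / k = 2 * pi * i / k - 2 * pi * j / k"
    by (simp add: diff_divide_distrib right_diff_distrib)
  then show ?thesis by (simp add: inner_real_3 cos_diff)
qed

lemma cos_pi_less:
  fixes n :: int
  assumes "1 < n" "n < 2 * int k - 1"
  shows "cos (pi * n / k) < cos (pi / k)"
proof (cases "n \<le> int k")
  case True
  have "k > 0" "real_of_int n \<le> k" using assms True by linarith+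
  then have "pi * n / k \<le> pi" "pi / k < pi * n / k"
    using assms by (auto simp: field_simps)
  then show ?thesis by (intro cos_monotone_0_pi) auto
next
  case False
  have k: "k > 0" using assms by linarith
  let ?m = "2 * int k - n"
  have m: "1 < real_of_int ?m" "real_of_int ?m \<le> k" using assms False by linarith+
  have "pi * ?m / k = 2 * pi - pi * n / k" using k by (simp add: field_simps)
  then have "cos (pi * ?m / k) = cos (pi * n / k)" by simp
  moreover have "pi * ?m / k \<le> pi" "pi / k < pi * ?m / k"
    using m k by (auto simp: divide_le_eq pos_divide_le_eq divide_strict_right_mono)
  then have "cos (pi * ?m / k) < cos (pi / k)" by (intro cos_monotone_0_pi) auto
  ultimately show ?thesis by simp
qed

lemma cos_pi_mod:
  fixes n :: int
  assumes "k > 0"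
  shows "cos (pi * n / k) = cos (pi * (n mod (2 * int k)) / k)"
proof -
  define q r where "q = n div (2 * int k)" and "r = n mod (2 * int k)"
  have "n = r + 2 * int k * q" by (simp add: q_def r_def)
  then have "pi * n / k = pi * r / k + 2 * pi * of_int q"
    using assms by (simp add: field_simps)
  then show ?thesis
    unfolding r_def[symmetric] by (simp only: cos_add cos_int_2pin sin_int_2pin mult_1_right mult_zero_right diff_0_right)
qed

lemma inner_equator_less_1:
  assumes "k > 0" "\<not> int k dvd i - j"
  shows "equator k i \<bullet> equator k j < 1"
proof -
  let ?r = "(i - j) mod int k"
  have r: "0 < ?r" "?r < int k"
    using assms pos_mod_sign[of "int k" "i - j"] pos_mod_bound[of "int k" "i - j"]
    by (auto simp: dvd_eq_mod_eq_0 simp del: pos_mod_sign pos_mod_bound)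
  have m: "(2 * (i - j)) mod (2 * int k) = 2 * ?r" by (simp only: mult_mod_right)
  have "equator k i \<bullet> equator k j = cos (pi * (2 * ?r) / k)"
    using cos_pi_mod[OF assms(1), of "2 * (i - j)"] unfolding inner_equator m
    by (simp add: mult.assoc mult.left_commute)
  moreover have "cos (pi * (2 * ?r) / k) < 1"
  proof -
    have "real_of_int ?r < real k" using r(2) by linarith
    then have "pi * ?r < pi * k" by (rule mult_strict_left_mono) simp
    then have "pi * ?r / k < pi" using assms(1) by (metis of_nat_0_less_iff pos_divide_less_eq)
    moreover have "0 < pi * ?r / k" using r(1) assms(1) by simp
    ultimately have "sin (pi * ?r / k) > 0" by (intro sin_gt_zero)
    moreover have "cos (pi * (2 * ?r) / k) = 1 - 2 * (sin (pi * ?r / k))\<^sup>2"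
      using cos_double_sin[of "pi * ?r / k"] by (simp add: mult.left_commute)
    ultimately show ?thesis by simp
  qed
  ultimately show ?thesis by simp
qed

lemma equator_eq_iff: "k > 0 \<Longrightarrow> equator k i = equator k j \<longleftrightarrow> int k dvd i - j"
  using equator_cong inner_equator_less_1 inner_equator[of k j j]
  by (metis cos_zero diff_self div_0 less_irrefl mult_zero_right of_int_0)

lemma range_equator: "k > 0 \<Longrightarrow> range (equator k) = (\<lambda>j. equator k (int j)) ` {..<k}"
proof
  assume k: "k > 0"
  show "range (equator k) \<subseteq> (\<lambda>j. equator k (int j)) ` {..<k}"
  proof clarify
    fix j
    have "equator k j = equator k (int (nat (j mod int k)))"
      using k by (intro equator_cong) (simp add: mod_eq_dvd_iff[symmetric])
    then show "equator k j \<in> (\<lambda>j. equator k (int j)) ` {..<k}"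
      using k by (intro image_eqI[of _ _ "nat (j mod int k)"]) (auto simp: nat_less_iff)
  qed
qed auto

lemma bipyramid_altdef:
  assumes "k > 0"
  shows "bipyramid k = convex hull (range (equator k) \<union> {apex 1, apex (-1)})"
proof -
  have "{vector [cos (2 * pi * real j / real k), sin (2 * pi * real j / real k), 0] | j. j < k}
    = (\<lambda>j. equator k (int j)) ` {..<k}"
    by (auto simp: equator_def)
  then show ?thesis by (simp add: bipyramid_def range_equator[OF assms] apex_def)
qed

lemma finite_bipyramid_vertices: "k > 0 \<Longrightarrow> finite (range (equator k) \<union> {apex 1, apex (-1)})"
  by (simp add: range_equator)

lemma polytope_bipyramid: "k > 0 \<Longrightarrow> polytope (bipyramid k)"
  using finite_bipyramid_vertices[of k] unfolding bipyramid_altdef polytope_def by blast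

lemma bipyramid_lateral_edge:
  assumes k: "k > 0" and s: "s \<in> {1, -1}"
  shows "closed_segment (apex s) (equator k j) face_of bipyramid k"
  unfolding bipyramid_altdef[OF k] segment_convex_hull
proof (rule face_of_convex_hull_supporting[OF finite_bipyramid_vertices[OF k], where u = "equator k j + apex s" and c = 1])
  show "{apex s, equator k j} \<subseteq> range (equator k) \<union> {apex 1, apex (- 1)}" using s by auto
  show "(equator k j + apex s) \<bullet> x = 1" if "x \<in> {apex s, equator k j}" for x
    using that s inner_equator[of k j j]
    by (auto simp: inner_add_left) (auto simp: inner_real_3)
  show "(equator k j + apex s) \<bullet> x < 1"
    if x: "x \<in> range (equator k) \<union> {apex 1, apex (- 1)} - {apex s, equator k j}" for x
  proof -
    consider i where "x = equator k i" "equator k i \<noteq> equator k j" | "x = apex (- s)"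
      using x s by force
    then show ?thesis
    proof cases
      case 1
      then have "equator k j \<bullet> x < 1"
        using inner_equator_less_1[OF k, of j i] equator_cong[of k j i] by metis
      then show ?thesis using 1 by (simp add: inner_add_left) (simp add: inner_real_3)
    qed (use s in \<open>auto simp: inner_real_3\<close>)
  qed
qed

lemma bipyramid_equatorial_edge:
  assumes k: "k \<ge> 3"
  shows "closed_segment (equator k j) (equator k (j + 1)) face_of bipyramid k"
proof -
  have k0: "k > 0" using k by simp
  define u :: "real^3" where "u = vector [cos (pi * (2 * j + 1) / k), sin (pi * (2 * j + 1) / k), 0]"
  have ui: "u \<bullet> equator k i = cos (pi * (2 * (i - j) - 1) / k)" for i
  proof -
    have "pi * (2 * (i - j) - 1) / k = 2 * pi * i / k - pi * (2 * j + 1) / k"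
      by (simp add: diff_divide_distrib[symmetric] algebra_simps)
    then show ?thesis by (simp add: u_def inner_real_3 cos_diff mult.commute)
  qed
  have pos: "cos (pi / k) > 0"
  proof (rule cos_gt_zero_pi)
    show "pi / k < pi / 2" using k by (intro divide_strict_left_mono) auto
    show "- (pi / 2) < pi / k" by (rule less_le_trans[of _ 0]) auto
  qed
  have "convex hull {equator k j, equator k (j + 1)} face_of convex hull (range (equator k) \<union> {apex 1, apex (-1)})"
  proof (rule face_of_convex_hull_supporting[OF finite_bipyramid_vertices[OF k0], where u = u and c = "cos (pi / k)"])
    show "{equator k j, equator k (j + 1)} \<subseteq> range (equator k) \<union> {apex 1, apex (-1)}" by auto
    show "u \<bullet> x = cos (pi / k)" if "x \<in> {equator k j, equator k (j + 1)}" for x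
      using that ui[of j] ui[of "j + 1"] by auto
    show "u \<bullet> x < cos (pi / k)"
      if x: "x \<in> range (equator k) \<union> {apex 1, apex (-1)} - {equator k j, equator k (j + 1)}" for x
    proof -
      consider i where "x = equator k i" "equator k i \<noteq> equator k j" "equator k i \<noteq> equator k (j + 1)"
        | "x = apex 1" | "x = apex (-1)"
        using x by auto
      then show ?thesis
      proof cases
        case 1
        let ?n = "2 * (i - j) - 1"
        let ?r = "?n mod (2 * int k)"
        have nd: "\<not> int k dvd i - j" "\<not> int k dvd i - (j + 1)"
          using 1 equator_cong by metis+
        have "odd ?r" by (simp add: dvd_mod_iff)
        have "0 \<le> ?r" "?r < 2 * int k" using k0 by auto
        have "?r \<noteq> 1"
        proof
          assume "?r = 1"
          then have "2 * int k dvd ?n - 1" using dvd_minus_mod[of "2 * int k" ?n] by simp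
          moreover have "?n - 1 = 2 * (i - (j + 1))" by simp
          ultimately show False using nd(2) by (metis dvd_mult_cancel_left zero_neq_numeral)
        qed
        moreover have "?r \<noteq> 2 * int k - 1"
        proof
          assume "?r = 2 * int k - 1"
          then have "2 * int k dvd ?n - (2 * int k - 1)"
            using dvd_minus_mod[of "2 * int k" ?n] by simp
          then have "2 * int k dvd ?n - (2 * int k - 1) + 2 * int k" by (rule dvd_add) simp
          moreover have "?n - (2 * int k - 1) + 2 * int k = 2 * (i - j)" by simp
          ultimately show False using nd(1) by (metis dvd_mult_cancel_left zero_neq_numeral)
        qed
        moreover have "?r \<noteq> 0" using \<open>odd ?r\<close> by auto
        ultimately have "1 < ?r" "?r < 2 * int k - 1"
          using \<open>0 \<le> ?r\<close> \<open>?r < 2 * int k\<close> by linarith+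
        then have "cos (pi * ?r / k) < cos (pi / k)" by (rule cos_pi_less)
        moreover have "u \<bullet> x = cos (pi * ?r / k)"
          using cos_pi_mod[OF k0, of ?n] ui[of i] 1(1) by simp
        ultimately show ?thesis by simp
      qed (use pos in \<open>auto simp: u_def inner_real_3\<close>)
    qed
  qed
  then show ?thesis by (simp add: bipyramid_altdef[OF k0] segment_convex_hull)
qed

section \<open>Tangent edges and Minkowski space\<close>

lemma tangent_closed_segment:
  fixes v w :: "real^3"
  assumes "v \<noteq> w" "tangent_to_unit_sphere (closed_segment v w)"
  shows "v \<bullet> v \<ge> 1" "w \<bullet> w \<ge> 1" "sqrt (v \<bullet> v - 1) * sqrt (w \<bullet> w - 1) = 1 - v \<bullet> w"
proof -
  obtain x where x: "x \<in> closed_segment v w" "affine hull {v, w} \<inter> sphere 0 1 = {x}"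
    using assms(2) by (auto simp: tangent_to_unit_sphere_def)
  define d where "d = w - v"
  have dd: "d \<bullet> d > 0" using assms(1) by (simp add: d_def)
  obtain s where s: "0 \<le> s" "s \<le> 1" "x = v + s *\<^sub>R d"
    using x(1) by (auto simp: closed_segment_def d_def algebra_simps)
  have line: "x + r *\<^sub>R d \<in> affine hull {v, w}" for r
  proof -
    have "x + r *\<^sub>R d = (1 - s - r) *\<^sub>R v + (s + r) *\<^sub>R w"
      by (simp add: s(3) d_def algebra_simps)
    then show ?thesis unfolding affine_hull_2 by fastforce
  qed
  have xx: "x \<bullet> x = 1" using x(2) by (auto simp: norm_eq_1)
  define r where "r = - 2 * (x \<bullet> d) / (d \<bullet> d)"
  have "(x + r *\<^sub>R d) \<bullet> (x + r *\<^sub>R d) = x \<bullet> x + r * (2 * (x \<bullet> d) + r * (d \<bullet> d))"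
    by (simp add: algebra_simps inner_commute)
  also have "\<dots> = 1" using dd xx by (simp add: r_def)
  finally have "x + r *\<^sub>R d \<in> sphere 0 1" by (simp add: norm_eq_1)
  with line[of r] x(2) have "x + r *\<^sub>R d = x" by blast
  then have xd: "x \<bullet> d = 0" using dd by (auto simp: r_def)
  have v: "v = x - s *\<^sub>R d" and w: "w = x + (1 - s) *\<^sub>R d"
    using s(3) by (auto simp: d_def algebra_simps)
  have vv: "v \<bullet> v - 1 = s\<^sup>2 * (d \<bullet> d)" and ww: "w \<bullet> w - 1 = (1 - s)\<^sup>2 * (d \<bullet> d)"
    and vw: "1 - v \<bullet> w = s * (1 - s) * (d \<bullet> d)"
    using xx xd by (simp_all add: v w inner_diff inner_add inner_commute power2_eq_square algebra_simps)
  show "v \<bullet> v \<ge> 1" using vv dd by (metis diff_ge_0_iff_ge inner_ge_zero mult_nonneg_nonneg zero_le_power2)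
  show "w \<bullet> w \<ge> 1" using ww dd by (metis diff_ge_0_iff_ge inner_ge_zero mult_nonneg_nonneg zero_le_power2)
  show "sqrt (v \<bullet> v - 1) * sqrt (w \<bullet> w - 1) = 1 - v \<bullet> w"
    unfolding vv ww vw using s(1,2) by (simp add: real_sqrt_mult)
qed

lemma extreme_points_not_collinear:
  fixes S :: "'a::euclidean_space set"
  assumes "x extreme_point_of S" "y extreme_point_of S" "z extreme_point_of S"
    and "x \<noteq> y" "y \<noteq> z" "x \<noteq> z"
  shows "\<not> collinear {x, y, z}"
proof
  assume "collinear {x, y, z}"
  then have "x \<in> open_segment y z \<or> y \<in> open_segment x z \<or> z \<in> open_segment x y"
    using assms(4-6) by (auto simp: collinear_between_cases between_mem_segment open_segment_def closed_segment_commute)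
  then show False using assms(1-3) unfolding extreme_point_of_def by blast
qed

text \<open>A vertex on the sphere would be the tangency point of all its edges. Seen from such a
  vertex \<open>v\<close>, tangency of the edge \<open>xy\<close> forces \<open>x\<close> and \<open>y\<close> into opposite directions.\<close>

lemma tangent_vertex_outside_sphere:
  fixes v x y z :: "real^3"
  assumes ext: "v extreme_point_of S" "y extreme_point_of S" "z extreme_point_of S"
    and ne: "v \<noteq> x" "v \<noteq> y" "v \<noteq> z" "x \<noteq> y" "x \<noteq> z" "y \<noteq> z"
    and tan: "tangent_to_unit_sphere (closed_segment v x)" "tangent_to_unit_sphere (closed_segment v y)"
      "tangent_to_unit_sphere (closed_segment v z)" "tangent_to_unit_sphere (closed_segment x y)"
      "tangent_to_unit_sphere (closed_segment x z)"
  shows "v \<bullet> v > 1"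
proof (rule ccontr)
  assume "\<not> v \<bullet> v > 1"
  then have vv: "v \<bullet> v = 1" using tangent_closed_segment(1)[OF ne(1) tan(1)] by simp
  have v0: "v \<bullet> (u - v) = 0" if "v \<noteq> u" "tangent_to_unit_sphere (closed_segment v u)" for u
    using tangent_closed_segment(3)[OF that] vv by (simp add: inner_diff)
  have opp: "\<exists>c. u - v = c *\<^sub>R (x - v)"
    if u: "v \<noteq> u" "tangent_to_unit_sphere (closed_segment v u)"
      "x \<noteq> u" "tangent_to_unit_sphere (closed_segment x u)" for u
  proof -
    define p q where "p = x - v" and "q = u - v"
    have "v \<bullet> p = 0" "v \<bullet> q = 0" using v0[OF ne(1) tan(1)] v0[OF u(1,2)] by (simp_all add: p_def q_def)
    then have "x \<bullet> x - 1 = p \<bullet> p" "u \<bullet> u - 1 = q \<bullet> q" "1 - x \<bullet> u = - (p \<bullet> q)"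
      using vv by (auto simp: p_def q_def inner_diff inner_commute)
    then have "norm p * norm q = - (p \<bullet> q)"
      using tangent_closed_segment(3)[OF u(3,4)] by (simp add: norm_eq_sqrt_inner)
    then have "p \<bullet> (- q) = norm p * norm (- q)" by simp
    then have "norm p *\<^sub>R (- q) = norm (- q) *\<^sub>R p" by (simp only: norm_cauchy_schwarz_eq)
    from arg_cong[OF this, of uminus] have "norm p *\<^sub>R q = (- norm q) *\<^sub>R p" by simp
    moreover have "norm p \<noteq> 0" using ne(1) by (simp add: p_def)
    ultimately have "q = (- norm q / norm p) *\<^sub>R p"
      by (simp only: eq_vector_fraction_iff if_False)
    then show ?thesis unfolding p_def q_def by blast
  qed
  obtain c where c: "y - v = c *\<^sub>R (x - v)" using opp[OF ne(2) tan(2) ne(4) tan(4)] by blast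
  obtain e where e: "z - v = e *\<^sub>R (x - v)" using opp[OF ne(3) tan(3) ne(5) tan(5)] by blast
  have "c \<noteq> 0" using c ne(2) by auto
  then have "z - v = (e / c) *\<^sub>R (y - v)" by (simp add: c e)
  then have "collinear {0, y - v, z - v}" unfolding collinear_lemma by blast
  then have "collinear {y, v, z}" using collinear_3[of y v z] by simp
  then show False
    using extreme_points_not_collinear[OF ext(2,1,3)] ne by auto
qed

lemma affine_recurrence_root_of_unity:
  fixes W :: "nat \<Rightarrow> 'a::euclidean_space"
  assumes k: "k \<ge> 3"
    and rec: "\<And>n. W (Suc (Suc n)) + W n = l *\<^sub>R W (Suc n) + C"
    and per: "\<And>n. W (n + k) = W n"
    and dist: "\<And>j. 0 < j \<Longrightarrow> j < k \<Longrightarrow> W j \<noteq> W 0"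
  obtains z :: complex where "z ^ k = 1" "\<And>j. 0 < j \<Longrightarrow> j < k \<Longrightarrow> z ^ j \<noteq> 1"
    "complex_of_real l = z + inverse z"
proof -
  define z where "z = (of_real l + csqrt ((of_real l)\<^sup>2 - 4)) / 2"
  define y where "y = (of_real l - csqrt ((of_real l)\<^sup>2 - 4)) / 2"
  have "z * y = ((of_real l)\<^sup>2 - (csqrt ((of_real l)\<^sup>2 - 4))\<^sup>2) / 4"
    by (simp add: z_def y_def power2_eq_square algebra_simps)
  then have zy: "z * y = 1" by simp
  then have z0: "z \<noteq> 0" and yz: "y = inverse z"
    by (auto simp: inverse_unique)
  have sum: "z + y = of_real l" by (simp add: z_def y_def flip: add_divide_distrib)
  define d :: "'a \<Rightarrow> nat \<Rightarrow> complex" where "d b n = of_real ((W (Suc n) - W n) \<bullet> b)" for b n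
  have drec: "d b (Suc (Suc n)) = (z + y) * d b (Suc n) - d b n" for b n
  proof -
    have "W (Suc (Suc m)) = l *\<^sub>R W (Suc m) + C - W m" for m
      using rec[of m] by (simp add: eq_diff_eq)
    from this[of n] this[of "Suc n"]
    have "W (Suc (Suc (Suc n))) - W (Suc (Suc n)) =
        (l *\<^sub>R W (Suc (Suc n)) + C - W (Suc n)) - (l *\<^sub>R W (Suc n) + C - W n)"
      by (simp only:)
    then have "W (Suc (Suc (Suc n))) - W (Suc (Suc n)) = l *\<^sub>R (W (Suc (Suc n)) - W (Suc n)) - (W (Suc n) - W n)"
      by (simp add: algebra_simps)
    then show ?thesis
      unfolding sum d_def by (simp add: inner_diff_left flip: of_real_mult of_real_diff)
  qed
  have geom: "d b (Suc n) - y * d b n = z ^ n * (d b 1 - y * d b 0)"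
    "d b (Suc n) - z * d b n = y ^ n * (d b 1 - z * d b 0)" for b n
  proof (induction n)
    case (Suc n)
    have "d b (Suc (Suc n)) - y * d b (Suc n) = z * (d b (Suc n) - y * d b n)"
      "d b (Suc (Suc n)) - z * d b (Suc n) = y * (d b (Suc n) - z * d b n)"
      using zy by (simp_all add: drec algebra_simps)
    with Suc show "d b (Suc (Suc n)) - y * d b (Suc n) = z ^ Suc n * (d b 1 - y * d b 0)"
      "d b (Suc (Suc n)) - z * d b (Suc n) = y ^ Suc n * (d b 1 - z * d b 0)" by simp_all
  qed simp_all
  have dper: "d b (n + k) = d b n" for b n
    using per[of n] per[of "Suc n"] by (simp add: d_def)
  have W10: "W (Suc 0) \<noteq> W 0" using dist[of 1] k by simp
  have zk: "z ^ k = 1"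
  proof -
    obtain b where b: "d b 0 \<noteq> 0"
      using W10 euclidean_eqI[of "W (Suc 0)" "W 0"] by (auto simp: d_def inner_diff_left)
    show ?thesis
    proof (cases "d b 1 - y * d b 0 = 0")
      case False
      then show ?thesis using geom(1)[of b k] dper[of b 0] dper[of b 1] by simp
    next
      case True
      have "d b (Suc n) = y * d b n" for n using geom(1)[of b n] True by simp
      then have "d b n = y ^ n * d b 0" for n by (induction n) simp_all
      from this[of k] dper[of b 0] b have "y ^ k = 1" by simp
      then show ?thesis using zy by (metis mult.right_neutral power_mult_distrib power_one)
    qed
  qed
  have not_periodic: False if j: "0 < j" "j < k" and dj: "\<And>b n. d b (n + j) = d b n" for j
  proof -
    have step: "W (Suc n + j) - W (Suc n) = W (n + j) - W n" for n
    proof -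
      have "(W (Suc (n + j)) - W (n + j)) \<bullet> b = (W (Suc n) - W n) \<bullet> b" for b
        using dj[of b n] by (simp add: d_def del: of_real_diff)
      then have "W (Suc (n + j)) - W (n + j) = W (Suc n) - W n"
        by (blast intro: euclidean_eqI)
      then show ?thesis by (simp add: algebra_simps)
    qed
    have const: "W (n + j) - W n = W j - W 0" for n
      by (induction n) (use step in auto)
    have "W (m * j) = W 0 + real m *\<^sub>R (W j - W 0)" for m
    proof (induction m)
      case (Suc m)
      have "W (Suc m * j) = W (m * j) + (W j - W 0)"
        using const[of "m * j"] by (simp add: diff_eq_eq add_ac)
      then show ?case by (simp add: Suc.IH scaleR_add_left add_ac)
    qed simp
    from this[of k] have "W (j * k) = W 0 + real k *\<^sub>R (W j - W 0)" by (simp add: mult.commute)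
    moreover have "W (m * k) = W 0" for m
    proof (induction m)
      case (Suc m)
      then show ?case using per[of "m * k"] by (simp add: add.commute)
    qed simp
    ultimately have "W j = W 0" using k by simp
    with dist[OF j] show False by simp
  qed
  have prim: "z ^ j \<noteq> 1" if j: "0 < j" "j < k" for j
  proof
    assume zj: "z ^ j = 1"
    then have yj: "y ^ j = 1" by (simp add: yz power_inverse)
    show False
    proof (cases "z = y")
      case False
      have "(z - y) * d b n = z ^ n * (d b 1 - y * d b 0) - y ^ n * (d b 1 - z * d b 0)" for b n
      proof -
        have "(z - y) * d b n = (d b (Suc n) - y * d b n) - (d b (Suc n) - z * d b n)"
          by (simp add: algebra_simps)
        then show ?thesis by (simp only: geom)
      qed
      then have "(z - y) * d b (n + j) = (z - y) * d b n" for b n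
        using zj yj by (simp add: power_add)
      then show False using not_periodic[OF j] False by simp
    next
      case True
      then have zz: "z * z = 1" using zy by simp
      have d1: "d b 1 = z * d b 0" for b
      proof -
        have "z ^ n * d b n = d b 0 + of_nat n * (z * (d b 1 - z * d b 0))" for n
        proof (induction n)
          case (Suc n)
          have "z ^ n * z ^ n = 1" using zz by (metis power_mult_distrib power_one)
          have "d b (Suc n) = z * d b n + z ^ n * (d b 1 - z * d b 0)"
            using geom(1)[of b n] True by (simp add: algebra_simps)
          then have "z ^ Suc n * d b (Suc n) = z ^ Suc n * (z * d b n + z ^ n * (d b 1 - z * d b 0))"
            by (simp only:)
          also have "\<dots> = (z * z) * (z ^ n * d b n)
              + z * (z ^ n * z ^ n) * (d b 1 - z * d b 0)"
            by (simp add: algebra_simps)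
          also have "\<dots> = z ^ n * d b n + z * (d b 1 - z * d b 0)"
            using zz \<open>z ^ n * z ^ n = 1\<close> by simp
          finally show ?case using Suc by (simp add: algebra_simps)
        qed simp
        from this[of k] zk dper[of b 0] k z0 show ?thesis by simp
      qed
      have "d b (n + 2) = d b n" for b n
      proof -
        have "d b (Suc m) = z * d b m" for m
          using geom(1)[of b m] True d1[of b] by simp
        then show ?thesis using zz by (simp add: numeral_2_eq_2 flip: mult.assoc)
      qed
      then show False using not_periodic[of 2] k by simp
    qed
  qed
  show thesis
    using that[OF zk prim] sum yz by simp
qed

definition lift :: "real^3 \<Rightarrow> real \<Rightarrow> (real^3) \<times> real" where
  "lift v t = (inverse t *\<^sub>R v, inverse t)"

definition lorentz :: "(real^3) \<times> real \<Rightarrow> (real^3) \<times> real \<Rightarrow> real" where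
  "lorentz p q = fst p \<bullet> fst q - snd p * snd q"

lemma lorentz_lift: "lorentz (lift v s) (lift w t) = (v \<bullet> w - 1) / (s * t)"
  by (simp add: lorentz_def lift_def divide_inverse algebra_simps)

lemma lorentz_add: "lorentz (p + q) r = lorentz p r + lorentz q r"
  and lorentz_diff: "lorentz (p - q) r = lorentz p r - lorentz q r"
  and lorentz_scaleR: "lorentz (c *\<^sub>R p) r = c * lorentz p r"
  and lorentz_commute: "lorentz p q = lorentz q p"
  by (simp_all add: lorentz_def inner_add_left inner_diff_left inner_commute algebra_simps)

lemma lift_eq_iff:
  assumes "s > 0" "t > 0"
  shows "lift v s = lift w t \<longleftrightarrow> v = w \<and> s = t"
  using assms by (auto simp: lift_def)

lemma independent_lift:
  assumes "\<not> collinear {a, b, w}" and t: "r > 0" "s > 0" "t > 0"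
  shows "independent {lift a r, lift b s, lift w t}"
    and "card {lift a r, lift b s, lift w t} = 3"
proof -
  have ne: "a \<noteq> b" "a \<noteq> w" "b \<noteq> w" using assms(1) by (auto simp: insert_commute)
  then have ne': "lift a r \<noteq> lift b s" "lift a r \<noteq> lift w t" "lift b s \<noteq> lift w t"
    using t by (auto simp: lift_eq_iff)
  then show "card {lift a r, lift b s, lift w t} = 3" by simp
  show "independent {lift a r, lift b s, lift w t}"
  proof
    assume "dependent {lift a r, lift b s, lift w t}"
    then obtain u where u: "u (lift a r) \<noteq> 0 \<or> u (lift b s) \<noteq> 0 \<or> u (lift w t) \<noteq> 0"
      "u (lift a r) *\<^sub>R lift a r + u (lift b s) *\<^sub>R lift b s + u (lift w t) *\<^sub>R lift w t = 0"
      using ne' by (auto simp: dependent_finite add.assoc)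
    define x y z where "x = u (lift a r) / r" and "y = u (lift b s) / s" and "z = u (lift w t) / t"
    have nz: "x \<noteq> 0 \<or> y \<noteq> 0 \<or> z \<noteq> 0" using u(1) t by (auto simp: x_def y_def z_def)
    have e: "x *\<^sub>R a + y *\<^sub>R b + z *\<^sub>R w = 0" "x + y + z = 0"
      using u(2) by (auto simp: lift_def x_def y_def z_def divide_inverse zero_prod_def)
    have "y *\<^sub>R (b - a) + z *\<^sub>R (w - a) = (x *\<^sub>R a + y *\<^sub>R b + z *\<^sub>R w) - (x + y + z) *\<^sub>R a"
      by (simp add: algebra_simps)
    then have lin: "y *\<^sub>R (b - a) + z *\<^sub>R (w - a) = 0" using e by simp
    have "collinear {0, b - a, w - a}"
    proof (cases "z = 0")
      case True
      then show ?thesis using lin nz e(2) by (auto simp: collinear_lemma)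
    next
      case False
      moreover have "z *\<^sub>R (w - a) = (- y) *\<^sub>R (b - a)"
        using lin by (simp add: add_eq_0_iff)
      ultimately have "w - a = (- y / z) *\<^sub>R (b - a)"
        by (simp only: eq_vector_fraction_iff if_False)
      then show ?thesis unfolding collinear_lemma by blast
    qed
    then have "collinear {b, a, w}" using collinear_3[of b a w] by simp
    with assms(1) show False by (simp add: insert_commute)
  qed
qed

lemma lorentz_complement:
  assumes ind: "independent {A, B, W}" "card {A, B, W} = 3"
    and D: "D \<noteq> 0" "lorentz D A = 0" "lorentz D B = 0" "lorentz D W = 0" "lorentz D S = 0"
  obtains l m n where "S = l *\<^sub>R W + m *\<^sub>R A + n *\<^sub>R B"
proof -
  define D' where "D' = (fst D, - snd D)"
  have L: "lorentz D p = D' \<bullet> p" for p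
    by (simp add: lorentz_def D'_def inner_prod_def)
  have "D' \<noteq> 0" using D(1) by (auto simp: D'_def prod_eq_iff)
  then have "dim {p. D' \<bullet> p = 0} = 3" by (simp add: dim_hyperplane)
  moreover have "dim (span {A, B, W}) = 3" using ind by (simp add: dim_eq_card_independent)
  moreover have "span {A, B, W} \<subseteq> {p. D' \<bullet> p = 0}"
    using D by (intro span_minimal subspace_hyperplane) (auto simp flip: L)
  ultimately have "span {A, B, W} = {p. D' \<bullet> p = 0}"
    by (intro subspace_dim_equal subspace_span subspace_hyperplane) auto
  then have "S \<in> span {A, B, W}" using D(5) by (simp flip: L)
  then obtain m n l where "S - m *\<^sub>R A - n *\<^sub>R B - l *\<^sub>R W = 0"
    by (auto simp: span_insert)
  then have "S = l *\<^sub>R W + m *\<^sub>R A + n *\<^sub>R B" by (simp add: algebra_simps)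
  then show thesis by (rule that)
qed

lemma equator_recurrence:
  fixes A B W U V :: "(real^3) \<times> real"
  assumes ind: "independent {A, B, W}" "card {A, B, W} = 3" and UV: "U \<noteq> V"
    and unit: "lorentz A A = 1" "lorentz B B = 1" "lorentz W W = 1" "lorentz U U = 1" "lorentz V V = 1"
    and edge: "lorentz W A = -1" "lorentz W B = -1" "lorentz U A = -1" "lorentz U B = -1"
      "lorentz V A = -1" "lorentz V B = -1" "lorentz U W = -1" "lorentz V W = -1"
    and beta: "lorentz A B = - \<beta>"
  shows "U + V = (2 * (3 - \<beta>) / (1 + \<beta>)) *\<^sub>R W + (4 / (1 + \<beta>)) *\<^sub>R (A + B)"
proof -
  have "lorentz (U - V) (U + V) = 0"
    using unit lorentz_commute[of U V]
    by (simp add: lorentz_commute[of _ "U + V"] lorentz_add)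
       (simp add: lorentz_commute[of _ "U - V"] lorentz_diff)
  then obtain l m n where S: "U + V = l *\<^sub>R W + m *\<^sub>R A + n *\<^sub>R B"
    using lorentz_complement[OF ind, of "U - V" "U + V"] UV edge by (auto simp: lorentz_diff)
  note * = arg_cong[OF S, of "\<lambda>p. lorentz p _"]
  have beta': "lorentz B A = - \<beta>" "lorentz A W = -1" "lorentz B W = -1"
    using beta edge by (simp_all add: lorentz_commute[of B A] lorentz_commute[of A W] lorentz_commute[of B W])
  have e: "-2 = - l + m - n * \<beta>" "-2 = - l - m * \<beta> + n" "-2 = l - m - n"
    using *[of A] *[of B] *[of W] edge unit beta beta' by (simp_all add: lorentz_add lorentz_scaleR)
  have "(m - n) * (1 + \<beta>) = 0" using e(1,2) by (simp add: algebra_simps)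
  moreover have b1: "1 + \<beta> \<noteq> 0"
  proof
    assume "1 + \<beta> = 0"
    then have "\<beta> = -1" by simp
    with e show False by simp
  qed
  ultimately have mn: "m = n" by simp
  then have "m * (1 + \<beta>) = 4" using e(1,3) by (simp add: algebra_simps)
  then have m: "m = 4 / (1 + \<beta>)" using b1 by (simp add: field_simps)
  have "l = 2 * m - 2" using e(3) mn by simp
  then have "l = 2 * (3 - \<beta>) / (1 + \<beta>)"
    using b1 by (simp add: m divide_simps)
  then show ?thesis using S mn m by (simp add: algebra_simps)
qed

section \<open>The lower bound\<close>

lemma apex_ne_equator [simp]: "s \<noteq> 0 \<Longrightarrow> apex s \<noteq> equator k j" "s \<noteq> 0 \<Longrightarrow> equator k j \<noteq> apex s"
  by (metis equator_apex_nth(3,6))+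

lemma apex_eq_iff [simp]: "apex s = apex t \<longleftrightarrow> s = t"
  by (metis equator_apex_nth(6))

lemma bipyramid_extreme_points:
  assumes "k > 0" "s \<in> {1, -1}"
  shows "apex s extreme_point_of bipyramid k" "equator k j extreme_point_of bipyramid k"
  using extreme_point_of_face[OF bipyramid_lateral_edge[OF assms, of j]]
  by (auto simp: extreme_point_of_segment)

lemma bipyramid_koebe_dimension:
  assumes k: "k \<ge> 3" and Q: "polytope Q" "combinatorially_equivalent (bipyramid k) Q"
    and tan: "\<And>e. e edge_of Q \<Longrightarrow> tangent_to_unit_sphere e"
    and n: "ring.dimension real_ring n \<rat> (coordinate_field Q)"
  shows "totient k \<le> 2 * n"
proof -
  have k0: "k > 0" using k by simp
  obtain g where g: "\<And>v. v extreme_point_of bipyramid k \<Longrightarrow> g v extreme_point_of Q"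
    "inj_on g {v. v extreme_point_of bipyramid k}"
    "\<And>v w. v \<noteq> w \<Longrightarrow> closed_segment v w face_of bipyramid k \<Longrightarrow> closed_segment (g v) (g w) edge_of Q"
    using combinatorially_equivalent_edges[OF polytope_bipyramid[OF k0] Q] by blast
  have extB: "apex 1 extreme_point_of bipyramid k" "apex (-1) extreme_point_of bipyramid k"
    "equator k j extreme_point_of bipyramid k" for j
    using bipyramid_extreme_points[OF k0] by auto
  have ginj: "g u = g v \<longleftrightarrow> u = v"
    if "u extreme_point_of bipyramid k" "v extreme_point_of bipyramid k" for u v
    using g(2) that by (auto simp: inj_on_def)
  define a b w where "a = g (apex 1)" and "b = g (apex (-1))" and "w j = g (equator k j)" for j
  have ext: "a extreme_point_of Q" "b extreme_point_of Q" "w j extreme_point_of Q" for j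
    using g(1) extB by (auto simp: a_def b_def w_def)
  have ne: "a \<noteq> b" "a \<noteq> w j" "w j \<noteq> a" "b \<noteq> w j" "w j \<noteq> b" for j
    using extB by (auto simp: a_def b_def w_def ginj)
  have w_eq: "w i = w j \<longleftrightarrow> int k dvd i - j" for i j
    using extB by (simp add: w_def ginj equator_eq_iff[OF k0])
  have w_ne: "w j \<noteq> w (j + 1)" "w (j + 1) \<noteq> w j" "w j \<noteq> w (j + 2)" for j
    using k by (auto simp: w_eq zdvd_not_zless dest: zdvd_imp_le)
  have tan_a: "tangent_to_unit_sphere (closed_segment a (w j))"
    and tan_b: "tangent_to_unit_sphere (closed_segment b (w j))"
    and tan_w: "tangent_to_unit_sphere (closed_segment (w j) (w (j + 1)))" for j
  proof -
    have "equator k j \<noteq> equator k (j + 1)" using w_ne(1)[of j] by (auto simp: w_def)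
    then show "tangent_to_unit_sphere (closed_segment (w j) (w (j + 1)))"
      unfolding w_def by (intro tan g(3) bipyramid_equatorial_edge[OF k])
    show "tangent_to_unit_sphere (closed_segment a (w j))"
      unfolding a_def w_def by (intro tan g(3) bipyramid_lateral_edge[OF k0]) simp_all
    show "tangent_to_unit_sphere (closed_segment b (w j))"
      unfolding b_def w_def by (intro tan g(3) bipyramid_lateral_edge[OF k0]) simp_all
  qed
  have tan_a': "tangent_to_unit_sphere (closed_segment (w j) a)"
    and tan_w': "tangent_to_unit_sphere (closed_segment (w (j + 1)) (w j))" for j
    by (subst closed_segment_commute, rule tan_a tan_w)+
  have shift: "j - 1 + 2 = j + 1" for j :: int by simp
  have out_a: "a \<bullet> a > 1"
    using tangent_vertex_outside_sphere[OF ext(1) ext(3)[of 0] ext(3)[of 2] ne(2)[of 1] ne(2) ne(2)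
        w_ne(2)[of 0, simplified] w_ne(1)[of 1, simplified] w_ne(3)[of 0, simplified] tan_a tan_a tan_a
        tan_w'[of 0, simplified] tan_w[of 1, simplified]] .
  have out_b: "b \<bullet> b > 1"
    using tangent_vertex_outside_sphere[OF ext(2) ext(3)[of 0] ext(3)[of 2] ne(4)[of 1] ne(4) ne(4)
        w_ne(2)[of 0, simplified] w_ne(1)[of 1, simplified] w_ne(3)[of 0, simplified] tan_b tan_b tan_b
        tan_w'[of 0, simplified] tan_w[of 1, simplified]] .
  have out_w: "w j \<bullet> w j > 1" for j
    using tangent_vertex_outside_sphere[OF ext(3)[of j] ext(3)[of "j - 1"] ext(3)[of "j + 1"] ne(3)[of j]
        w_ne(2)[of "j - 1", simplified] w_ne(1)[of j] ne(2) ne(2) w_ne(3)[of "j - 1", unfolded shift]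
        tan_a'[of j] tan_w'[of "j - 1", simplified] tan_w[of j] tan_a tan_a] .
  define \<tau> where "\<tau> v = sqrt (v \<bullet> v - 1)" for v :: "real^3"
  have \<tau>pos: "\<tau> a > 0" "\<tau> b > 0" "\<tau> (w j) > 0" for j
    using out_a out_b out_w by (auto simp: \<tau>_def)
  have \<tau>sq: "\<tau> a * \<tau> a = a \<bullet> a - 1" "\<tau> b * \<tau> b = b \<bullet> b - 1" "\<tau> (w j) * \<tau> (w j) = w j \<bullet> w j - 1" for j
    using out_a out_b out_w[of j] by (auto simp: \<tau>_def)
  have edge: "\<tau> a * \<tau> (w j) = 1 - a \<bullet> w j" "\<tau> b * \<tau> (w j) = 1 - b \<bullet> w j"
    "\<tau> (w j) * \<tau> (w (j + 1)) = 1 - w j \<bullet> w (j + 1)" for j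
    unfolding \<tau>_def
    using tangent_closed_segment(3)[OF ne(2) tan_a] tangent_closed_segment(3)[OF ne(4) tan_b]
      tangent_closed_segment(3)[OF w_ne(1) tan_w] by auto
  define L where "L v = lift v (\<tau> v)" for v
  have L1: "lorentz (L u) (L v) = -1" if "\<tau> u * \<tau> v = 1 - u \<bullet> v" "\<tau> u > 0" "\<tau> v > 0" for u v
  proof -
    have "u \<bullet> v - 1 = - (\<tau> u * \<tau> v)" using that(1) by simp
    then show ?thesis using that(2,3) by (simp add: L_def lorentz_lift)
  qed
  have Lunit: "lorentz (L v) (L v) = 1" if "\<tau> v * \<tau> v = v \<bullet> v - 1" "\<tau> v > 0" for v
    using that by (simp add: L_def lorentz_lift flip: that(1))
  define \<beta> where "\<beta> = (1 - a \<bullet> b) / (\<tau> a * \<tau> b)"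
  have beta: "lorentz (L a) (L b) = - \<beta>"
    by (simp add: L_def lorentz_lift \<beta>_def minus_divide_left)
  define W where "W n = L (w (int n))" for n
  define l where "l = 2 * (3 - \<beta>) / (1 + \<beta>)"
  have rec: "W (Suc (Suc n)) + W n = l *\<^sub>R W (Suc n) + (4 / (1 + \<beta>)) *\<^sub>R (L a + L b)" for n
    unfolding l_def
  proof (rule equator_recurrence[OF _ _ _ Lunit[OF \<tau>sq(1)] Lunit[OF \<tau>sq(2)] _ _ _ _ _ _ _ _ _ _ _ beta])
    have nc: "\<not> collinear {a, b, w (int (Suc n))}"
      using extreme_points_not_collinear[OF ext(1) ext(2) ext(3)] ne by blast
    show "independent {L a, L b, W (Suc n)}" "card {L a, L b, W (Suc n)} = 3"
      unfolding W_def L_def by (rule independent_lift[OF nc \<tau>pos])+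
    have "w (int (Suc (Suc n))) \<noteq> w (int n)" using w_ne(3)[of "int n"] by (auto simp: add.commute)
    then show "W (Suc (Suc n)) \<noteq> W n" by (simp add: W_def L_def lift_eq_iff \<tau>pos)
    show "lorentz (W (Suc (Suc n))) (W (Suc n)) = - 1" "lorentz (W n) (W (Suc n)) = - 1"
      using L1[OF edge(3)[of "int n"]] L1[OF edge(3)[of "int n + 1"]] \<tau>pos
      by (simp_all add: W_def lorentz_commute[of "L (w (int n + 2))"] add_ac)
  qed (use \<tau>pos Lunit[OF \<tau>sq(3)] L1[OF edge(1)] L1[OF edge(2)] in
        \<open>simp_all add: W_def lorentz_commute[of _ "L a"] lorentz_commute[of _ "L b"]\<close>)
  have per: "W (n + k) = W n" for n
    using w_eq[of "int (n + k)" "int n"] by (simp add: W_def)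
  have dist: "W j \<noteq> W 0" if "0 < j" "j < k" for j
  proof -
    have "\<not> int k dvd int j - int 0" using that by (simp add: nat_dvd_not_less)
    then have "w (int j) \<noteq> w (int 0)" by (simp only: w_eq not_False_eq_True)
    then show ?thesis by (simp add: W_def L_def lift_eq_iff \<tau>pos)
  qed
  obtain z :: complex where z: "z ^ k = 1" "\<And>j. 0 < j \<Longrightarrow> j < k \<Longrightarrow> z ^ j \<noteq> 1"
    "complex_of_real l = z + inverse z"
    using affine_recurrence_root_of_unity[OF k rec per dist] by blast
  define E where "E = coordinate_field Q"
  interpret real_field: field real_ring by rule
  have E: "subfield E real_ring"
    unfolding E_def coordinate_field_def by (rule real_field.generate_field_is_subfield) simp
  have coord: "v $ i \<in> E" if "v extreme_point_of Q" for v :: "real^3" and i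
    unfolding E_def coordinate_field_def using that
    by (intro generate_field.incl) (auto simp: vertex_coordinates_def)
  have RatsE: "q \<in> E" if "q \<in> \<rat>" for q
    unfolding E_def coordinate_field_def using that by (intro generate_field.incl) auto
  note closed = subfield_closed[OF E]
  have inner: "u \<bullet> v \<in> E" if "u extreme_point_of Q" "v extreme_point_of Q" for u v
    unfolding inner_real_3 using coord that by (intro closed(3,4)) auto
  have "\<beta> \<in> E"
  proof -
    have "\<tau> a * \<tau> b * (\<tau> (w 0) * \<tau> (w 0)) = (\<tau> a * \<tau> (w 0)) * (\<tau> b * \<tau> (w 0))"
      by (simp add: algebra_simps)
    then have "\<tau> a * \<tau> b = (1 - a \<bullet> w 0) * (1 - b \<bullet> w 0) / (w 0 \<bullet> w 0 - 1)"
      unfolding edge \<tau>sq using out_w[of 0] by (simp add: eq_divide_eq)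
    then show ?thesis unfolding \<beta>_def
      using closed(1) inner ext by (auto intro!: closed(3-6))
  qed
  moreover have "2 \<in> E" "3 \<in> E" by (auto intro: RatsE)
  ultimately have "l \<in> E" unfolding l_def by (intro closed(1,3-6))
  then show ?thesis
    using totient_le_twice_dimension[OF k0 z(1,2) n[folded E_def] E _ z(3)] by simp
qed

lemma koebe_degree_bipyramid_ge:
  assumes "k \<ge> 3" "is_realization (bipyramid k) P"
  shows "enat ((totient k + 1) div 2) \<le> koebe_degree P"
  unfolding koebe_degree_def
proof (rule INF_greatest)
  fix Q assume "Q \<in> {Q. koebe_realization P Q}"
  then have Q: "polytope Q" "combinatorially_equivalent P Q"
    "\<And>e. e edge_of Q \<Longrightarrow> tangent_to_unit_sphere e"
    by (auto simp: koebe_realization_def is_realization_def)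
  have comb: "combinatorially_equivalent (bipyramid k) Q"
    using assms(2) Q(2) combinatorially_equivalent_trans by (auto simp: is_realization_def)
  interpret real_field: field real_ring by rule
  show "enat ((totient k + 1) div 2) \<le> degree_over_rationals (coordinate_field Q)"
  proof (cases "ring.finite_dimension real_ring \<rat> (coordinate_field Q)")
    case True
    from real_field.finite_dimensionE[OF subfield_Rats True]
    have "ring.dimension real_ring (ring.dim real_ring \<rat> (coordinate_field Q)) \<rat> (coordinate_field Q)"
      by (simp add: over_def)
    from bipyramid_koebe_dimension[OF assms(1) Q(1) comb Q(3) this]
    show ?thesis using True by (simp add: degree_over_rationals_def)
  qed (simp add: degree_over_rationals_def)
qed

section \<open>A Koebe realization with algebraic coordinates\<close>

lemma edge_of_polytope_segment:
  fixes S :: "'a::euclidean_space set"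
  assumes "polytope S" "e edge_of S"
  obtains u v where "e = closed_segment u v" "u \<noteq> v" "u extreme_point_of S" "v extreme_point_of S"
proof -
  have e: "e face_of S" "aff_dim e = 1" using assms(2) by (auto simp: edge_of_def)
  have pe: "polytope e" using face_of_polytope_polytope[OF assms(1) e(1)] .
  have ne: "e \<noteq> {}" using e(2) by auto
  have col: "collinear e" using e(2) by (simp add: collinear_aff_dim)
  obtain u v where uv: "e = closed_segment u v"
    using compact_convex_collinear_segment[OF ne polytope_imp_compact[OF pe] polytope_imp_convex[OF pe] col] .
  have "u \<noteq> v" using e(2) uv by auto
  moreover have "u extreme_point_of S" "v extreme_point_of S"
    using extreme_point_of_face[OF e(1), of u] extreme_point_of_face[OF e(1), of v]
    by (auto simp: uv extreme_point_of_segment)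
  ultimately show thesis using uv that by blast
qed

lemma face_of_contains_midpoint:
  assumes "F face_of S" "a \<in> S" "b \<in> S" "midpoint a b \<in> F"
  shows "a \<in> F"
proof (cases "a = b")
  case False
  then have "midpoint a b \<in> open_segment a b" by simp
  then show ?thesis using face_ofD[OF assms(1) _ assms(2-4)] by blast
qed (use assms(4) in simp)

lemma bipyramid_memI:
  assumes "k > 0"
  shows "apex 1 \<in> bipyramid k" "apex (-1) \<in> bipyramid k" "equator k j \<in> bipyramid k"
  unfolding bipyramid_altdef[OF assms] by (auto intro: hull_inc)

lemma bipyramid_extreme_point_cases:
  assumes "k > 0" "v extreme_point_of bipyramid k"
  obtains s where "s \<in> {1, -1}" "v = apex s" | j where "v = equator k j"
proof -
  have "v \<in> range (equator k) \<union> {apex 1, apex (-1)}"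
    using assms extreme_point_of_convex_hull by (auto simp: bipyramid_altdef)
  then show thesis using that by auto
qed

lemma midpoint_equator:
  "midpoint (equator k i) (equator k j) =
     cos (pi * (i - j) / k) *\<^sub>R vector [cos (pi * (i + j) / k), sin (pi * (i + j) / k), 0]"
proof -
  have "2 * pi * i / k = pi * (i + j) / k + pi * (i - j) / k"
    "2 * pi * j / k = pi * (i + j) / k - pi * (i - j) / k"
    by (simp_all add: algebra_simps flip: add_divide_distrib diff_divide_distrib)
  then show ?thesis
    by (simp add: vec_eq_iff forall_3 midpoint_def cos_add sin_add cos_diff sin_diff)
qed

lemma edge_no_third_extreme_point:
  fixes S :: "'a::euclidean_space set"
  assumes "closed_segment u v face_of S" "x extreme_point_of S" "x \<in> closed_segment u v"
  shows "x = u \<or> x = v"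
  using extreme_point_of_face[OF assms(1), of x] assms(2,3) by (simp add: extreme_point_of_segment)

lemma bipyramid_axis_not_edge:
  assumes k: "k \<ge> 3" and s: "s \<in> {1, -1}" "t \<in> {1, -1}" "s \<noteq> t"
  shows "\<not> closed_segment (apex s) (apex t) face_of bipyramid k"
proof
  assume F: "closed_segment (apex s) (apex t) face_of bipyramid k"
  have k0: "k > 0" using k by simp
  define j where "j = int (k div 2)"
  define p where "p = midpoint (equator k j) (equator k (- j))"
  define c where "c = cos (2 * pi * j / k)"
  have p: "p = c *\<^sub>R equator k 0"
    by (simp add: p_def midpoint_equator c_def vec_eq_iff forall_3 mult.left_commute mult.assoc)
  have c: "c < 0"
  proof -
    have "real k < 4 * real_of_int j" "2 * real_of_int j \<le> real k"
      using k unfolding j_def by linarith+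
    then have "pi / 2 < 2 * pi * j / k" "2 * pi * j / k \<le> pi"
      using k0 by (simp_all add: field_simps)
    then show ?thesis unfolding c_def using cos_monotone_0_pi[of "pi / 2" "2 * pi * j / k"] by simp
  qed
  have "p \<in> bipyramid k"
    unfolding p_def using bipyramid_memI[OF k0] polytope_imp_convex[OF polytope_bipyramid[OF k0]]
    by (meson convex_contains_segment midpoint_in_closed_segment subsetD)
  have "midpoint (apex s) (apex t) = 0"
    using s by (auto simp: vec_eq_iff forall_3 midpoint_def)
  then have zero: "0 \<in> closed_segment (apex s) (apex t)" by (metis midpoint_in_closed_segment)
  have eq0: "equator k 0 \<noteq> 0" by (auto simp: vec_eq_iff forall_3)
  have "0 \<in> open_segment (equator k 0) p"
  proof -
    have "0 = (1 - 1 / (1 - c)) *\<^sub>R equator k 0 + (1 / (1 - c)) *\<^sub>R p"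
      using c by (simp add: p field_simps flip: scaleR_add_left)
    moreover have "0 < 1 / (1 - c)" "1 / (1 - c) < 1" using c by simp_all
    moreover have "equator k 0 \<noteq> p"
    proof
      assume "equator k 0 = p"
      then have "(1 - c) *\<^sub>R equator k 0 = 0" by (simp add: p scaleR_diff_left)
      then show False using c eq0 by simp
    qed
    ultimately show ?thesis unfolding in_segment(2) by blast
  qed
  then have "equator k 0 \<in> closed_segment (apex s) (apex t)"
    using face_ofD[OF F _ _ _ zero] \<open>p \<in> bipyramid k\<close> bipyramid_memI[OF k0] by blast
  then have "equator k 0 = apex s \<or> equator k 0 = apex t"
    using edge_no_third_extreme_point[OF F] bipyramid_extreme_points(2)[OF k0, of 1] by simp
  then show False using s by auto
qed

text \<open>The midpoint of a diagonal of the regular polygon lies between the midpoints of the two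
  parallel chords next to it, so a face containing it contains a third vertex.\<close>

lemma bipyramid_diagonal_not_edge:
  assumes k: "k > 0" and r: "2 \<le> r" "r \<le> int k - 2"
  shows "\<not> closed_segment (equator k (j + r)) (equator k j) face_of bipyramid k"
proof
  assume F: "closed_segment (equator k (j + r)) (equator k j) face_of bipyramid k"
  define D :: "real^3" where "D = vector [cos (pi * (2 * j + r) / k), sin (pi * (2 * j + r) / k), 0]"
  define c where "c q = cos (pi * of_int q / k)" for q :: int
  have mid: "midpoint (equator k (j + r - i)) (equator k (j + i)) = c (r - 2 * i) *\<^sub>R D" for i
    by (simp add: midpoint_equator D_def c_def algebra_simps)
  have mem: "c (r - 2 * i) *\<^sub>R D \<in> bipyramid k" for i
    unfolding mid[symmetric]
    using bipyramid_memI[OF k] polytope_imp_convex[OF polytope_bipyramid[OF k]]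
    by (meson convex_contains_segment midpoint_in_closed_segment subsetD)
  have mono: "c q < c p" if "0 \<le> p" "p < q" "q \<le> int k" for p q
    unfolding c_def
  proof (rule cos_monotone_0_pi)
    show "0 \<le> pi * p / k" using that by simp
    show "pi * p / k < pi * q / k" using that k by (simp add: divide_strict_right_mono)
    have "real_of_int q \<le> real k" using that by linarith
    then show "pi * q / k \<le> pi" using k by (simp add: divide_le_eq)
  qed
  have c: "c (r + 2) < c r" "c r < c (r - 2)" using mono r by auto
  have D0: "D \<noteq> 0"
  proof
    assume "D = 0"
    then have "cos (pi * (2 * j + r) / k) = 0" "sin (pi * (2 * j + r) / k) = 0"
      by (auto simp: D_def vec_eq_iff forall_3)
    then show False using sin_cos_squared_add[of "pi * (2 * j + r) / k"] by simp
  qed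
  have "c r *\<^sub>R D \<in> open_segment (c (r - 2) *\<^sub>R D) (c (r + 2) *\<^sub>R D)"
  proof -
    define u where "u = (c (r - 2) - c r) / (c (r - 2) - c (r + 2))"
    have "u * (c (r - 2) - c (r + 2)) = c (r - 2) - c r" using c by (simp add: u_def)
    then have "(1 - u) * c (r - 2) + u * c (r + 2) = c r" by (simp add: algebra_simps)
    then have "c r *\<^sub>R D = (1 - u) *\<^sub>R (c (r - 2) *\<^sub>R D) + u *\<^sub>R (c (r + 2) *\<^sub>R D)"
      by (simp flip: scaleR_add_left)
    moreover have "0 < u" "u < 1" using c by (simp_all add: u_def)
    moreover have "c (r - 2) *\<^sub>R D \<noteq> c (r + 2) *\<^sub>R D" using c D0 by simp
    ultimately show ?thesis unfolding in_segment(2) by blast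
  qed
  moreover have "c r *\<^sub>R D \<in> closed_segment (equator k (j + r)) (equator k j)"
    using mid[of 0] midpoint_in_closed_segment[of "equator k (j + r)" "equator k j"] by simp
  ultimately have "c (r - 2) *\<^sub>R D \<in> closed_segment (equator k (j + r)) (equator k j)"
    using face_ofD[OF F] mem[of 1] mem[of "-1"] by simp
  then have "midpoint (equator k (j + 1)) (equator k (j + r - 1)) \<in> closed_segment (equator k (j + r)) (equator k j)"
    using mid[of 1] by (simp add: midpoint_sym)
  then have "equator k (j + 1) \<in> closed_segment (equator k (j + r)) (equator k j)"
    using face_of_contains_midpoint[OF F] bipyramid_memI(3)[OF k] by blast
  then have "equator k (j + 1) = equator k (j + r) \<or> equator k (j + 1) = equator k j"
    using edge_no_third_extreme_point[OF F] bipyramid_extreme_points(2)[OF k, of 1] by simp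
  then have "int k dvd r - 1 \<or> int k dvd 1"
    by (auto simp: equator_eq_iff[OF k] dvd_diff_commute)
  then show False using r zdvd_imp_le[of "int k" "r - 1"] zdvd_imp_le[of "int k" 1] by auto
qed

lemma bipyramid_edge_cases:
  assumes k: "k \<ge> 3" and e: "e edge_of bipyramid k"
  obtains s j where "s \<in> {1, -1}" "e = closed_segment (apex s) (equator k j)"
  | j where "e = closed_segment (equator k j) (equator k (j + 1))"
proof -
  have k0: "k > 0" using k by simp
  obtain u v where uv: "e = closed_segment u v" "u \<noteq> v"
    "u extreme_point_of bipyramid k" "v extreme_point_of bipyramid k"
    using edge_of_polytope_segment[OF polytope_bipyramid[OF k0] e] .
  have F: "closed_segment u v face_of bipyramid k" using e uv(1) by (simp add: edge_of_def)
  show thesis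
  proof (rule bipyramid_extreme_point_cases[OF k0 uv(3)])
    fix s assume s: "s \<in> {1, -1}" "u = apex s"
    show thesis
    proof (rule bipyramid_extreme_point_cases[OF k0 uv(4)])
      fix t assume t: "t \<in> {1, -1}" "v = apex t"
      then show thesis using bipyramid_axis_not_edge[OF k s(1) t(1)] F s uv(2) by auto
    next
      fix j assume "v = equator k j"
      then show thesis using that(1)[OF s(1)] uv(1) s(2) by blast
    qed
  next
    fix i assume i: "u = equator k i"
    show thesis
    proof (rule bipyramid_extreme_point_cases[OF k0 uv(4)])
      fix s assume s: "s \<in> {1, -1}" "v = apex s"
      then show thesis using that(1)[OF s(1), of i] uv(1) i closed_segment_commute by metis
    next
      fix j assume j: "v = equator k j"
      define r where "r = (i - j) mod int k"
      have "equator k i = equator k (j + r)"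
      proof (rule equator_cong)
        have "i - (j + r) = (i - j) - (i - j) mod int k" by (simp add: r_def)
        then show "int k dvd i - (j + r)" by (metis dvd_minus_mod)
      qed
      then have u: "u = equator k (j + r)" using i by simp
      have r: "0 \<le> r" "r < int k" using k0 by (auto simp: r_def)
      have "r \<noteq> 0" using u j uv(2) by auto
      moreover have "\<not> (2 \<le> r \<and> r \<le> int k - 2)"
        using bipyramid_diagonal_not_edge[OF k0, of r j] F u j by auto
      ultimately consider "r = 1" | "r = int k - 1" using r by linarith
      then show thesis
      proof cases
        case 1
        then show thesis using that(2)[of j] uv(1) u j closed_segment_commute by metis
      next
        case 2
        then have "u = equator k (j - 1)" using u by (auto intro: equator_cong)
        then show thesis using that(2)[of "j - 1"] uv(1) j by simp
      qed
    qed
  qed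
qed

lemma aff_dim_bipyramid:
  assumes "k \<ge> 3"
  shows "aff_dim (bipyramid k) = 3"
proof -
  let ?S = "range (equator k) \<union> {apex 1, apex (-1)}"
  have k0: "k > 0" using assms by simp
  have "midpoint (apex 1) (apex (-1)) = 0" by (simp add: vec_eq_iff forall_3 midpoint_def)
  then have "0 \<in> closed_segment (apex 1) (apex (-1))" by (metis midpoint_in_closed_segment)
  moreover have "closed_segment (apex 1) (apex (-1)) \<subseteq> affine hull ?S"
    unfolding segment_convex_hull
    by (rule order_trans[OF convex_hull_subset_affine_hull hull_mono]) auto
  ultimately have "aff_dim ?S = int (dim ?S)" by (intro aff_dim_zero) auto
  moreover have "span ?S = UNIV"
  proof -
    have sinp: "sin (2 * pi / k) > 0"
    proof (rule sin_gt_zero)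
      show "2 * pi / k < pi" using assms by (simp add: field_simps)
    qed (use k0 in simp)
    have "x \<in> span ?S" for x :: "real^3"
    proof -
      let ?c = "x $ 2 / sin (2 * pi / k)"
      have "x = (x $ 1 - ?c * cos (2 * pi / k)) *\<^sub>R equator k 0 + ?c *\<^sub>R equator k 1 + x $ 3 *\<^sub>R apex 1"
        using sinp by (simp add: vec_eq_iff forall_3)
      moreover have "equator k 0 \<in> span ?S" "equator k 1 \<in> span ?S" "apex 1 \<in> span ?S"
        by (auto intro: span_base)
      ultimately show ?thesis by (metis span_add span_scale)
    qed
    then show ?thesis by auto
  qed
  then have "dim ?S = dim (UNIV :: (real^3) set)" by (metis dim_span)
  then have "dim ?S = 3" by simp
  ultimately show ?thesis by (simp add: bipyramid_altdef[OF k0] aff_dim_convex_hull)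
qed

lemma tangent_to_unit_sphereI:
  fixes v w x :: "real^3"
  assumes "v \<noteq> w" "x \<in> closed_segment v w" "x \<bullet> x = 1" "x \<bullet> (w - v) = 0"
  shows "tangent_to_unit_sphere (closed_segment v w)"
  unfolding tangent_to_unit_sphere_def
proof (intro bexI[OF _ assms(2)] equalityI subsetI)
  obtain s where s: "x = v + s *\<^sub>R (w - v)"
    using assms(2) by (auto simp: closed_segment_def algebra_simps)
  fix y assume "y \<in> affine hull closed_segment v w \<inter> sphere 0 1"
  then have y: "y \<in> affine hull {v, w}" "y \<bullet> y = 1" by (auto simp: norm_eq_1)
  then obtain p q where "p + q = 1" "y = p *\<^sub>R v + q *\<^sub>R w" by (auto simp: affine_hull_2)
  then have "y = v + q *\<^sub>R (w - v)" by (simp add: algebra_simps flip: scaleR_add_left)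
  then have yx: "y = x + (q - s) *\<^sub>R (w - v)" using s by (simp add: scaleR_diff_left)
  then have "y \<bullet> y = x \<bullet> x + (q - s)\<^sup>2 * ((w - v) \<bullet> (w - v))"
    using assms(4) by (simp add: inner_add inner_commute power2_eq_square)
  then have "(q - s)\<^sup>2 * ((w - v) \<bullet> (w - v)) = 0" using y(2) assms(3) by simp
  then have "q = s" using assms(1) by simp
  then show "y \<in> {x}" using yx by simp
next
  fix y assume "y \<in> {x}"
  then show "y \<in> affine hull closed_segment v w \<inter> sphere 0 1"
    using assms(2,3) hull_subset[of "closed_segment v w" affine] by (auto simp: norm_eq_1)
qed

definition koebe_scaling :: "nat \<Rightarrow> real^3 \<Rightarrow> real^3" where
  "koebe_scaling k x = vector [x $ 1 / cos (pi / k), x $ 2 / cos (pi / k), x $ 3 / sin (pi / k)]"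

lemma koebe_scaling_nth [simp]:
  "koebe_scaling k x $ 1 = x $ 1 / cos (pi / k)" "koebe_scaling k x $ 2 = x $ 2 / cos (pi / k)"
  "koebe_scaling k x $ 3 = x $ 3 / sin (pi / k)"
  by (simp_all add: koebe_scaling_def)

lemma linear_koebe_scaling: "linear (koebe_scaling k)"
  by (intro linearI) (simp_all add: vec_eq_iff forall_3 add_divide_distrib)

lemma cos_sin_pi_div_pos:
  assumes "k \<ge> 3"
  shows "cos (pi / real k) > 0" "sin (pi / real k) > 0"
proof -
  have "pi / k < pi / 2" using assms by (intro divide_strict_left_mono) auto
  moreover have "pi / k > 0" using assms by simp
  ultimately show "cos (pi / real k) > 0" "sin (pi / real k) > 0"
    by (intro cos_gt_zero_pi sin_gt_zero; linarith)+
qed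

lemma inj_koebe_scaling: "k \<ge> 3 \<Longrightarrow> inj (koebe_scaling k)"
  using cos_sin_pi_div_pos[of k]
  by (intro injI) (auto simp: vec_eq_iff forall_3 dest: spec[of _ 1] spec[of _ 2] spec[of _ 3])

lemma koebe_scaling_edges_tangent:
  assumes k: "k \<ge> 3" and e: "e edge_of koebe_scaling k ` bipyramid k"
  shows "tangent_to_unit_sphere e"
proof -
  let ?h = "koebe_scaling k"
  define c s where "c = cos (pi / k)" and "s = sin (pi / k)"
  have cs: "c > 0" "s > 0" using cos_sin_pi_div_pos[OF k] by (simp_all add: c_def s_def)
  have cs1: "c * c + s * s = 1" using sin_cos_squared_add2[of "pi / k"] by (simp add: c_def s_def power2_eq_square)
  note lin = linear_koebe_scaling[of k] and inj = inj_koebe_scaling[OF k]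
  have "e \<in> {F. F face_of ?h ` bipyramid k}" using e by (simp add: edge_of_def)
  then obtain F where F: "F face_of bipyramid k" "e = ?h ` F"
    unfolding faces_of_linear_image[OF lin inj] by auto
  then have "F edge_of bipyramid k"
    using e by (simp add: edge_of_def aff_dim_injective_linear_image[OF lin inj])
  then show ?thesis
  proof (cases rule: bipyramid_edge_cases[OF k, consumes 1])
    case (1 t j)
    let ?v = "?h (apex t)" and ?w = "?h (equator k j)"
    let ?x = "(s * s) *\<^sub>R ?v + (c * c) *\<^sub>R ?w"
    define p q where "p = cos (2 * pi * j / k)" and "q = sin (2 * pi * j / k)"
    have e: "e = closed_segment ?v ?w"
      using F(2) 1(2) closed_segment_linear_image[OF lin] by simp
    have t: "t * t = 1" using 1(1) by auto
    have pq: "p * p + q * q = 1"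
      using sin_cos_squared_add2[of "2 * pi * j / k"] by (simp add: p_def q_def power2_eq_square)
    have vw: "?v = vector [0, 0, t / s]" "?w = vector [p / c, q / c, 0]"
      by (simp_all add: vec_eq_iff forall_3 p_def q_def c_def s_def)
    have x: "?x = vector [c * p, c * q, s * t]"
      unfolding vw using cs by (simp add: vec_eq_iff forall_3)
    show ?thesis
      unfolding e
    proof (rule tangent_to_unit_sphereI)
      have "apex t \<noteq> equator k j" using 1(1) by auto
      then show "?v \<noteq> ?w" using inj by (simp add: inj_eq)
      have "s * s = 1 - c * c" "c * c \<le> 1" using cs1 zero_le_square[of s] by linarith+
      then show "?x \<in> closed_segment ?v ?w" unfolding in_segment by (auto intro!: exI[of _ "c * c"])
      have "?x \<bullet> ?x = c * c * (p * p + q * q) + s * s * (t * t)"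
        unfolding x by (simp add: inner_real_3 algebra_simps)
      also have "\<dots> = 1" by (simp only: pq t mult_1_right cs1)
      finally show "?x \<bullet> ?x = 1" .
      have "?x \<bullet> (?w - ?v) = (p * p + q * q) - t * t"
        unfolding x vw using cs by (simp add: inner_real_3)
      also have "\<dots> = 0" by (simp only: pq t diff_self)
      finally show "?x \<bullet> (?w - ?v) = 0" .
    qed
  next
    case (2 j)
    let ?v = "?h (equator k j)" and ?w = "?h (equator k (j + 1))"
    let ?x = "midpoint ?v ?w"
    let ?b = "pi * (2 * j + 1) / k"
    have e: "e = closed_segment ?v ?w"
      using F(2) 2 closed_segment_linear_image[OF lin] by simp
    have "?x = ?h (midpoint (equator k (j + 1)) (equator k j))"
      by (simp add: midpoint_def linear_add[OF lin] linear_cmul[OF lin] add.commute)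
    also have "midpoint (equator k (j + 1)) (equator k j) = c *\<^sub>R vector [cos ?b, sin ?b, 0]"
      by (simp add: midpoint_equator c_def algebra_simps)
    finally have x: "?x = vector [cos ?b, sin ?b, 0]"
      using cs by (simp add: vec_eq_iff forall_3 flip: c_def)
    show ?thesis
      unfolding e
    proof (rule tangent_to_unit_sphereI)
      have "\<not> int k dvd j - (j + 1)" using k by auto
      then have "equator k j \<noteq> equator k (j + 1)" using k by (simp add: equator_eq_iff)
      then show "?v \<noteq> ?w" using inj by (simp add: inj_eq)
      show "?x \<in> closed_segment ?v ?w" by simp
      show "?x \<bullet> ?x = 1"
        unfolding x using sin_cos_squared_add2[of ?b] by (simp add: inner_real_3 power2_eq_square)
      have "?h (equator k i) \<bullet> ?h (equator k i) = 1 / (c * c)" for i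
      proof -
        have "cos a * cos a + sin a * sin a = 1" for a :: real
          using sin_cos_squared_add2[of a] by (simp add: power2_eq_square)
        then show ?thesis
          by (simp add: inner_real_3 flip: c_def add_divide_distrib)
      qed
      moreover have "midpoint a b \<bullet> (b - a) = (b \<bullet> b - a \<bullet> a) / 2" for a b :: "real^3"
        by (simp add: midpoint_def inner_add_left inner_add_right inner_diff_right inner_commute[of b a]
            field_simps)
      ultimately show "?x \<bullet> (?w - ?v) = 0" by (simp only: diff_self div_0)
    qed
  qed
qed

lemma koebe_degree_bipyramid_finite:
  assumes k: "k \<ge> 3"
  shows "koebe_degree (bipyramid k) < \<infinity>"
proof -
  let ?h = "koebe_scaling k"
  let ?Q = "?h ` bipyramid k"
  let ?S = "range (equator k) \<union> {apex 1, apex (-1)}"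
  have k0: "k > 0" using k by simp
  note lin = linear_koebe_scaling[of k] and inj = inj_koebe_scaling[OF k]
  have "koebe_realization (bipyramid k) ?Q"
    unfolding koebe_realization_def is_realization_def
    using polytope_linear_image[OF lin polytope_bipyramid[OF k0]]
      combinatorially_equivalent_linear_image[OF lin inj] koebe_scaling_edges_tangent[OF k] by blast
  then have "koebe_degree (bipyramid k) \<le> degree_over_rationals (coordinate_field ?Q)"
    unfolding koebe_degree_def by (intro INF_lower) simp
  moreover have "ring.finite_dimension real_ring \<rat> (coordinate_field ?Q)"
    unfolding coordinate_field_def
  proof (rule finite_dimension_generate_field)
    interpret real_field: field real_ring by rule
    let ?A = "{x. (real_field.algebraic over \<rat>) x}"
    have A: "subfield ?A real_ring"
      using real_field.subfield_of_algebraics[OF subfield_Rats] by (simp add: over_def)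
    note closed = subfield_closed[OF A]
    have cosA: "cos x \<in> ?A" if "n > 0" "cos (real n * x) = 1" for n x
      using algebraic_cos[OF that(1), of x 1] that(2) by simp
    have sinA: "sin x \<in> ?A" if "n > 0" "cos (real n * (pi / 2 - x)) = 1" for n x
      using cosA[OF that] by (simp add: cos_diff)
    have ext: "v \<in> ?h ` ?S" if "v extreme_point_of ?Q" for v
    proof -
      have "?Q = convex hull (?h ` ?S)"
        by (simp only: bipyramid_altdef[OF k0] convex_hull_linear_image[OF lin])
      then show ?thesis using that extreme_point_of_convex_hull by metis
    qed
    then have "vertex_coordinates ?Q \<subseteq> (\<lambda>(v, i). v $ i) ` (?h ` ?S \<times> UNIV)"
      by (auto simp: vertex_coordinates_def image_iff) blast
    then show "finite (vertex_coordinates ?Q)"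
      by (rule finite_subset) (use finite_bipyramid_vertices[OF k0] in simp)
    have cpi: "cos (pi / k) \<in> ?A"
      by (rule cosA[of "2 * k"]) (use k0 in simp_all)
    have spi: "sin (pi / k) \<in> ?A"
    proof (rule sinA[of "4 * k"])
      have "real (4 * k) * (pi / 2 - pi / k) = 2 * pi * of_int (int k - 2)"
        using k0 by (simp add: field_simps)
      then show "cos (real (4 * k) * (pi / 2 - pi / k)) = 1" by (simp only: cos_int_2pin)
    qed (use k0 in simp)
    have cj: "cos (2 * pi * j / k) \<in> ?A" for j :: int
    proof (rule cosA[of k])
      have "real k * (2 * pi * j / k) = 2 * pi * of_int j" using k0 by simp
      then show "cos (real k * (2 * pi * j / k)) = 1" by (simp only: cos_int_2pin)
    qed (use k0 in simp)
    have sj: "sin (2 * pi * j / k) \<in> ?A" for j :: int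
    proof (rule sinA[of "4 * k"])
      have "real (4 * k) * (pi / 2 - 2 * pi * j / k) = 2 * pi * of_int (int k - 4 * j)"
        using k0 by (simp add: field_simps)
      then show "cos (real (4 * k) * (pi / 2 - 2 * pi * j / k)) = 1" by (simp only: cos_int_2pin)
    qed (use k0 in simp)
    fix x assume "x \<in> vertex_coordinates ?Q"
    then obtain v :: "real^3" and i where x: "x = v $ i" "v extreme_point_of ?Q"
      by (auto simp: vertex_coordinates_def)
    then obtain u where u: "u \<in> ?S" "v = ?h u" using ext by auto
    have "0 - 1 \<in> ?A" by (intro closed)
    then have "u $ l \<in> ?A" for l
      using u(1) cj sj closed(1,2) exhaust_3[of l] by auto
    then have "v $ l \<in> ?A" for l
      using cpi spi closed(6) exhaust_3[of l] u(2) by auto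
    then show "(real_field.algebraic over \<rat>) x" using x(1) by simp
  qed
  ultimately have "koebe_degree (bipyramid k) \<le> enat (ring.dim real_ring \<rat> (coordinate_field ?Q))"
    by (simp add: degree_over_rationals_def)
  then show ?thesis by (rule le_less_trans) simp
qed

theorem theorem20:
  shows "(\<forall>k::nat. \<forall>P::(real^3) set. 4 \<le> k \<longrightarrow> is_realization (bipyramid k) P \<longrightarrow>
            ereal (real (totient k) / 4) \<le> ereal_of_enat (koebe_degree P)) \<and>
         (\<forall>C::nat. \<exists>P::(real^3) set. three_polytope P \<and>
            enat C < koebe_degree P \<and> koebe_degree P < \<infinity>)"
proof (intro conjI allI impI)
  fix k :: nat and P :: "(real^3) set"
  assume k: "4 \<le> k" and P: "is_realization (bipyramid k) P"
  have "ereal (real (totient k) / 4) \<le> ereal_of_enat (enat ((totient k + 1) div 2))"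
  proof -
    have "real (totient k) \<le> 2 * real ((totient k + 1) div 2)" by linarith
    then show ?thesis by simp
  qed
  also have "\<dots> \<le> ereal_of_enat (koebe_degree P)"
    using koebe_degree_bipyramid_ge[OF _ P] k by (simp only: ereal_of_enat_le_iff)
  finally show "ereal (real (totient k) / 4) \<le> ereal_of_enat (koebe_degree P)" .
next
  fix C :: nat
  obtain p :: nat where p: "prime p" "2 * C + 3 < p"
    using bigger_prime by blast
  have p3: "p \<ge> 3" using p(2) by simp
  have poly: "polytope (bipyramid p)" by (rule polytope_bipyramid) (use p3 in simp)
  have "combinatorially_equivalent (bipyramid p) (id ` bipyramid p)"
    by (intro combinatorially_equivalent_linear_image linear_id inj_on_id)
  then have "is_realization (bipyramid p) (bipyramid p)"
    unfolding is_realization_def image_id id_apply using poly by blast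
  note ge = koebe_degree_bipyramid_ge[OF p3 this]
  have "C < (totient p + 1) div 2" using p by (simp add: totient_prime)
  then have "enat C < koebe_degree (bipyramid p)"
    by (intro less_le_trans[OF _ ge]) simp
  moreover have "three_polytope (bipyramid p)"
    unfolding three_polytope_def using poly aff_dim_bipyramid[OF p3] by blast
  ultimately show "\<exists>P. three_polytope P \<and> enat C < koebe_degree P \<and> koebe_degree P < \<infinity>"
    using koebe_degree_bipyramid_finite[OF p3] by blast
qed

end
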